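(* Consider the randomly horizontally directed lattice $\mathbb{Z}^2_{\varepsilon}$ with randomness decaying in power $\beta$ (defined in the context), and the simple random walk $(M_n)_{n\ge 0}$ on it started at $(0,0)$. 1. If $\beta<1$, then for almost every realisation of the environment $(\lambda_y,\rho_y)_{y\in\mathbb{Z}}$ the simple random walk is transient, i.e. $\sum_{n\ge 0}\mathbb{P}_{(0,0)}(M_n=(0,0)\mid \varepsilon)<\infty$. 2. If $\beta>1$, then for almost every realisation of the environment $(\lambda_y,\rho_y)_{y\in\mathbb{Z}}$ the simple random walk is recurrent, i.e. $\sum_{n\ge 0}\mathbb{P}_{(0,0)}(M_n=(0,0)\mid \varepsilon)=\infty$.
   Context: Directed lattice: given a sequence $\varepsilon=(\varepsilon_y)_{y\in\mathbb{Z}}\in\{-1,1\}^{\mathbb{Z}}$, $\mathbb{Z}^2_{\varepsilon}$ is the directed graph on vertex set $\mathbb{Z}^2$ in which, from a vertex $u=(u_1,u_2)$, the allowed (directed) edges go to $(u_1,u_2+1)$, to $(u_1,u_2-1)$ (vertical edges, usable in both directions), and to $(u_1+\varepsilon_{u_2},u_2)$ (the horizontal edge at level $u_2$ is one-way, in direction $\varepsilon_{u_2}$). The simple random walk on $\mathbb{Z}^2_\varepsilon$ is the Markov chain $(M_n)$ on $\mathbb{Z}^2$ with $P(u,v)=1/3$ if $(u,v)$ is an allowed edge and $0$ otherwise. Randomly horizontally directed lattice with randomness decaying in power $\beta$: let $Q\ge 2$ be an even integer and $f:\mathbb{Z}\to\{-1,1\}$ a $Q$-periodic function with $\sum_{y=1}^Q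 f(y)=0$; let $(\rho_y)_{y\in\mathbb{Z}}$ be i.i.d. uniform on $\{-1,1\}$; let $(\lambda_y)_{y\in\mathbb{Z}}$ be independent $\{0,1\}$-valued random variables, independent of $(\rho_y)$, with $\mathbb{P}(\lambda_y=1)=c|y|^{-\beta}$ for all sufficiently large $|y|$, for some constant $c>0$. Set $\varepsilon_y=(1-\lambda_y)f(y)+\lambda_y\rho_y$. The walk is run in the fixed (quenched) environment $\varepsilon$. *)

theory Defs
  imports "HOL-Probability.Probability"
begin

definition nbrs :: "(int \<Rightarrow> int) \<Rightarrow> int \<times> int \<Rightarrow> (int \<times> int) list" where
  "nbrs e u = [(fst u, snd u + 1), (fst u, snd u - 1), (fst u + e (snd u), snd u)]"

fun walk_prob :: "(int \<Rightarrow> int) \<Rightarrow> nat \<Rightarrow> int \<times> int \<Rightarrow> int \<times> int \<Rightarrow> real" where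
  "walk_prob e 0 u v = (if u = v then 1 else 0)"
| "walk_prob e (Suc n) u v = (\<Sum>w \<leftarrow> nbrs e u. walk_prob e n w v / 3)"

definition env_measure :: "(int \<Rightarrow> real) \<Rightarrow> (int \<Rightarrow> bool \<times> bool) measure" where
  "env_measure p = PiM UNIV (\<lambda>y. measure_pmf (pair_pmf (bernoulli_pmf (p y)) (bernoulli_pmf (1/2))))"

definition lam_of :: "(int \<Rightarrow> bool \<times> bool) \<Rightarrow> int \<Rightarrow> int" where
  "lam_of \<omega> y = (if fst (\<omega> y) then 1 else 0)"

definition rho_of :: "(int \<Rightarrow> bool \<times> bool) \<Rightarrow> int \<Rightarrow> int" where
  "rho_of \<omega> y = (if snd (\<omega> y) then 1 else -1)"

definition eps_of :: "(int \<Rightarrow> int) \<Rightarrow> (int \<Rightarrow> bool \<times> bool) \<Rightarrow> int \<Rightarrow> int" where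
  "eps_of f \<omega> y = (1 - lam_of \<omega> y) * f y + lam_of \<omega> y * rho_of \<omega> y"

end

theory Submission
  imports Defs "HOL-Real_Asymp.Real_Asymp"
begin

text \<open>Fourier transform in the horizontal coordinate turns the Green function at the origin into the integral over
  \<open>\<theta>\<close> of the real part of \<open>V 0\<close>, where \<open>V\<close> solves a one-dimensional Schroedinger equation with complex potential
  \<open>1 - cos \<theta> + \<i> sin \<theta> e y\<close>. This real part equals the energy of \<open>V\<close>, of the form
  \<open>\<parallel>\<nabla>V\<parallel>\<^sup>2 + (1 - cos \<theta>) \<parallel>V\<parallel>\<^sup>2\<close> up to constants.

  If \<open>\<beta> > 1\<close>, then by Borel-Cantelli only finitely many lines are random, so the orientations have bounded partial
  sums. Testing the equation with a tent of width \<open>1 / \<theta>\<close> and summing the drift term by parts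
  shows that the energy is at least of order \<open>1 / \<theta>\<close>, which is not integrable.

  If \<open>\<beta> < 1\<close>, the equation is tested against bumps supported on many disjoint blocks at distance \<open>r\<close> from the
  origin. In a typical block the weighted sum of the orientations is of the order of the square root of a small power
  of \<open>r\<close>, while \<open>V\<close> differs from \<open>V 0\<close> by at most \<open>\<surd>(r * energy)\<close>; as \<open>V 0\<close> is at least the energy, the energy
  is at most \<open>\<theta> powr (\<delta> - 1)\<close> for some \<open>\<delta> > 0\<close>, which is integrable. Hoeffding's inequality across the blocks and
  Borel-Cantelli give the required fluctuations almost surely at all scales.\<close>

section \<open>The killed walk and its Fourier transform\<close>

text \<open>The imaginary part of \<open>V 0\<close> is never controlled. In the upper bound the
  tests reach the energy only through \<open>E \<le> norm (V 0)\<close>: an estimate of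
  \<open>(norm (V 0))^2\<close> by \<open>E\<close> times a factor bounds \<open>E\<close> by that
  factor once one \<open>E\<close> cancels. A single block is not enough for transience. A second
  moment for its weighted sum gives no summable failure probability, and the cheap bound on its
  partial sums, the number of random sites, is about the square of their typical size. With
  \<open>N\<close> disjoint blocks of length \<open>n\<close> the norms of \<open>V\<close> over the
  blocks add up to at most the global ones, while the squared sums add up to about \<open>N\<close>
  times a typical square \<open>T^2\<close>. This leaves room for the crude bound and turns
  Hoeffding's exponent into a power of the scale. With \<open>r = N * n\<close> the outcome is, up
  to constants, \<open>E \<le> r + 1 / (\<theta>^2 * r * T^2)\<close>. For \<open>T\<close> of order
  1 the best \<open>r\<close> gives exactly the borderline \<open>1 / \<theta>\<close>, so any
  positive power of \<open>r\<close> in \<open>T^2\<close> decides.\<close>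

fun killed :: "int \<Rightarrow> (int \<Rightarrow> int) \<Rightarrow> nat \<Rightarrow> int \<Rightarrow> int \<Rightarrow> real" where
  "killed K e 0 x y = (if x = 0 \<and> y = 0 then 1 else 0)"
| "killed K e (Suc n) x y = (if \<bar>y\<bar> \<le> K
     then (killed K e n x (y+1) + killed K e n x (y-1) + killed K e n (x + e y) y) / 3 else 0)"

text \<open>The sum of \<open>killed K e n x y * cis (\<theta> * x)\<close> over \<open>x\<close>,
  given by its recursion so that no sum over \<open>x\<close> is handled. Both recursions act on the
  starting point, with the origin as target, so the coefficient at height \<open>y\<close> is that
  of the line \<open>y\<close> itself.\<close>

fun killed_hat :: "int \<Rightarrow> (int \<Rightarrow> int) \<Rightarrow> real \<Rightarrow> nat \<Rightarrow> int \<Rightarrow> complex" where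
  "killed_hat K e \<theta> 0 y = (if y = 0 then 1 else 0)"
| "killed_hat K e \<theta> (Suc n) y = (if \<bar>y\<bar> \<le> K
     then (killed_hat K e \<theta> n (y+1) + killed_hat K e \<theta> n (y-1) + cis (- (\<theta> * real_of_int (e y))) * killed_hat K e \<theta> n y) / 3 else 0)"

lemma walk_prob_nonneg: "0 \<le> walk_prob e n u v"
  by (induction n arbitrary: u) (auto simp: nbrs_def)

lemma killed_nonneg: "0 \<le> killed K e n x y"
  by (induction n arbitrary: x y) auto

lemma killed_le_walk_prob: "killed K e n x y \<le> walk_prob e n (x, y) (0, 0)"
proof (induction n arbitrary: x y)
  case (Suc n)
  show ?case
    using Suc[of x "y+1"] Suc[of x "y-1"] Suc[of "x + e y" y]
    by (auto simp: nbrs_def walk_prob_nonneg)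
qed auto

text \<open>The height changes by at most one per step, so within \<open>n\<close> steps the killing
  is not met.\<close>

lemma killed_eq_walk_prob: "int n + \<bar>y\<bar> \<le> K \<Longrightarrow> killed K e n x y = walk_prob e n (x, y) (0, 0)"
  by (induction n arbitrary: x y) (auto simp: nbrs_def)

lemma cis_has_integral:
  fixes x :: int
  shows "((\<lambda>\<theta>. cis (- (\<theta> * real_of_int x))) has_integral (if x = 0 then 2 * pi else 0)) {-pi..pi}"
proof (cases "x = 0")
  case True
  then show ?thesis using has_integral_const_real[of "1::complex" "-pi" pi] by (simp add: scaleR_conv_of_real)
next
  case False
  let ?F = "\<lambda>\<theta>. cis (- (\<theta> * real_of_int x)) / (- \<i> * of_int x)"
  have "((\<lambda>\<theta>. cis (- (\<theta> * real_of_int x))) has_integral (?F pi - ?F (-pi))) {-pi..pi}"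
  proof (rule fundamental_theorem_of_calculus)
    fix t :: real
    have eq: "?F = (\<lambda>\<theta>. exp (of_real \<theta> * (- \<i> * of_int x)) / (- \<i> * of_int x))"
      by (auto simp: cis_conv_exp mult_ac)
    have "((\<lambda>z. exp (z * (- \<i> * of_int x)) / (- \<i> * of_int x)) has_field_derivative
            exp (of_real t * (- \<i> * of_int x))) (at (of_real t))"
      using False by (auto intro!: derivative_eq_intros simp: field_simps)
    from has_vector_derivative_real_field[OF this]
    show "(?F has_vector_derivative cis (- (t * real_of_int x))) (at t within {-pi..pi})"
      unfolding eq by (simp add: cis_conv_exp mult_ac)
  qed auto
  moreover have "cis (- (pi * real_of_int x)) = cis (pi * real_of_int x)"
    using sin_times_pi_eq_0[of "real_of_int x"] by (simp add: complex_eq_iff mult.commute)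
  ultimately show ?thesis using False by simp
qed

lemma killed_hat_norm_le: "norm (killed_hat K e \<theta> n y) \<le> 1"
proof (induction n arbitrary: y)
  case (Suc n)
  have "norm (killed_hat K e \<theta> n (y+1) + killed_hat K e \<theta> n (y-1) + cis (- (\<theta> * real_of_int (e y))) * killed_hat K e \<theta> n y) \<le> 1 + 1 + 1"
    by (intro order_trans[OF norm_triangle_ineq] add_mono Suc) (simp add: norm_mult Suc)
  then show ?case by (simp add: norm_divide)
qed auto

lemma killed_hat_continuous: "continuous_on X (\<lambda>\<theta>. killed_hat K e \<theta> n y)"
proof (induction n arbitrary: y)
  case (Suc n)
  show ?case by (cases "\<bar>y\<bar> \<le> K") (auto intro!: continuous_intros Suc)
qed auto

lemma killed_hat_outside: "0 \<le> K \<Longrightarrow> \<bar>y\<bar> > K \<Longrightarrow> killed_hat K e \<theta> n y = 0"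
  by (cases n) auto

text \<open>Fourier inversion by induction on time: a horizontal step shifts \<open>x\<close> by
  \<open>e y\<close>, which is multiplication by \<open>cis (- (\<theta> * e y))\<close>; at time 0
  it is the orthogonality of characters.\<close>

lemma killed_fourier:
  "((\<lambda>\<theta>. cis (- (\<theta> * real_of_int x)) * killed_hat K e \<theta> n y) has_integral (2 * pi * killed K e n x y)) {-pi..pi}"
proof (induction n arbitrary: x y)
  case 0
  show ?case using cis_has_integral[of x] by auto
next
  case (Suc n)
  have cis3: "cis (- (\<theta> * real_of_int x)) * (cis (- (\<theta> * real_of_int (e y))) * z)
     = cis (- (\<theta> * real_of_int (x + e y))) * z" for \<theta> z
    by (simp add: cis_mult algebra_simps flip: mult.assoc)
  have "((\<lambda>\<theta>. (cis (- (\<theta> * real_of_int x)) * killed_hat K e \<theta> n (y+1)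
      + cis (- (\<theta> * real_of_int x)) * killed_hat K e \<theta> n (y-1)
      + cis (- (\<theta> * real_of_int (x + e y))) * killed_hat K e \<theta> n y) / 3) has_integral
      (of_real (2*pi*killed K e n x (y+1)) + of_real (2*pi*killed K e n x (y-1)) + of_real (2*pi*killed K e n (x + e y) y)) / 3) {-pi..pi}"
    by (intro has_integral_divide has_integral_add Suc)
  also have "(\<lambda>\<theta>. (cis (- (\<theta> * real_of_int x)) * killed_hat K e \<theta> n (y+1)
      + cis (- (\<theta> * real_of_int x)) * killed_hat K e \<theta> n (y-1)
      + cis (- (\<theta> * real_of_int (x + e y))) * killed_hat K e \<theta> n y) / 3)
     = (\<lambda>\<theta>. cis (- (\<theta> * real_of_int x)) * ((killed_hat K e \<theta> n (y+1) + killed_hat K e \<theta> n (y-1)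
      + cis (- (\<theta> * real_of_int (e y))) * killed_hat K e \<theta> n y) / 3))"
    unfolding cis3[symmetric] by (simp only: distrib_left times_divide_eq_right)
  finally show ?case
    by (cases "\<bar>y\<bar> \<le> K") (simp_all add: distrib_left del: of_real_mult)
qed

text \<open>Killing the walk outside \<open>\<bar>y\<bar> \<le> K\<close> keeps all sums over \<open>y\<close> finite; the weight \<open>s ^ n\<close> makes the
  resolvent converge without any spectral information.\<close>

definition resolv :: "int \<Rightarrow> (int \<Rightarrow> int) \<Rightarrow> real \<Rightarrow> real \<Rightarrow> int \<Rightarrow> complex" where
  "resolv K e s \<theta> y = (\<Sum>n. of_real (s ^ n) * killed_hat K e \<theta> n y)"

lemma norm_killed_hat_term: "0 \<le> s \<Longrightarrow> norm (of_real s ^ n * killed_hat K e \<theta> n y) \<le> s ^ n"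
  using killed_hat_norm_le[of K e \<theta> n y] by (simp add: norm_mult norm_power mult_left_le)

lemma resolv_summable: "0 \<le> s \<Longrightarrow> s < 1 \<Longrightarrow> summable (\<lambda>n. of_real (s ^ n) * killed_hat K e \<theta> n y)"
  by (rule summable_comparison_test'[of "\<lambda>n. s ^ n" 0]) (auto intro: summable_geometric simp: norm_killed_hat_term)

lemma resolv_outside: "0 \<le> K \<Longrightarrow> \<bar>y\<bar> > K \<Longrightarrow> resolv K e s \<theta> y = 0"
  by (simp add: resolv_def killed_hat_outside)

text \<open>Decomposition at the first step, summed against \<open>s ^ n\<close>.\<close>

lemma resolv_eqn:
  assumes "0 \<le> s" "s < 1" "\<bar>y\<bar> \<le> K"
  shows "resolv K e s \<theta> y = (if y = 0 then 1 else 0) + of_real (s / 3) *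
     (resolv K e s \<theta> (y+1) + resolv K e s \<theta> (y-1) + cis (- (\<theta> * real_of_int (e y))) * resolv K e s \<theta> y)"
proof -
  let ?t = "\<lambda>y n. of_real (s ^ n) * killed_hat K e \<theta> n y"
  have sm: "\<And>y. summable (?t y)" by (rule resolv_summable[OF assms(1,2)])
  have "(\<Sum>n. ?t y n) = ?t y 0 + (\<Sum>n. ?t y (Suc n))" using suminf_split_head[OF sm[of y]] by simp
  also have "(\<lambda>n. ?t y (Suc n)) = (\<lambda>n. of_real (s / 3) * (?t (y+1) n + ?t (y-1) n + cis (- (\<theta> * real_of_int (e y))) * ?t y n))"
    using assms(3) by (auto simp: fun_eq_iff algebra_simps)
  also have "(\<Sum>n. \<dots> n) = of_real (s / 3) * ((\<Sum>n. ?t (y+1) n) + (\<Sum>n. ?t (y-1) n) + cis (- (\<theta> * real_of_int (e y))) * (\<Sum>n. ?t y n))"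
    by (subst suminf_mult, intro summable_add summable_mult sm,
        subst suminf_add[symmetric], intro summable_add sm, intro summable_mult sm,
        subst suminf_add[symmetric], intro sm, intro sm,
        subst suminf_mult, intro sm, rule refl)
  also have "?t y 0 = (if y = 0 then 1 else 0)" by simp
  finally show ?thesis unfolding resolv_def .
qed

text \<open>The partial sums converge uniformly in \<open>\<theta>\<close>, dominated by
  \<open>s ^ n\<close>, so sum and integral may be exchanged. The generating function is real, hence
  only the real part of the resolvent contributes.\<close>

lemma killed_gf:
  assumes s: "0 \<le> s" "s < 1"
  shows "summable (\<lambda>n. s ^ n * killed K e n 0 0)"
    and "((\<lambda>\<theta>. Re (resolv K e s \<theta> 0)) has_integral (2 * pi * (\<Sum>n. s ^ n * killed K e n 0 0))) {-pi..pi}"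
proof -
  let ?f = "\<lambda>N \<theta>. \<Sum>n<N. of_real (s ^ n) * killed_hat K e \<theta> n 0"
  have ul: "uniform_limit {-pi..pi} ?f (\<lambda>\<theta>. resolv K e s \<theta> 0) sequentially"
    unfolding resolv_def
    by (rule Weierstrass_m_test[of _ _ "\<lambda>n. s ^ n"]) (auto simp: norm_killed_hat_term s intro!: summable_geometric)
  have I: "(?f N has_integral of_real (2 * pi * (\<Sum>n<N. s ^ n * killed K e n 0 0))) {-pi..pi}" for N
  proof -
    have "(?f N has_integral (\<Sum>n<N. of_real (s^n) * of_real (2 * pi * killed K e n 0 0))) {-pi..pi}"
      using killed_fourier[of 0 K e _ 0] by (intro has_integral_sum has_integral_mult_right) (auto simp: cis_zero)
    then show ?thesis by (simp add: sum_distrib_left mult_ac)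
  qed
  obtain I' J where *: "\<And>N. (?f N has_integral I' N) {-pi..pi}" "((\<lambda>\<theta>. resolv K e s \<theta> 0) has_integral J) {-pi..pi}" "I' \<longlonglongrightarrow> J"
  proof (rule uniform_limit_integral[OF ul])
    show "continuous_on {-pi..pi} (?f N)" for N by (intro continuous_intros killed_hat_continuous)
  qed auto
  have "I' = (\<lambda>N. of_real (2 * pi * (\<Sum>n<N. s ^ n * killed K e n 0 0)))"
    using has_integral_unique[OF *(1) I] by auto
  with *(3) have "(\<lambda>N. Re (of_real (2 * pi * (\<Sum>n<N. s ^ n * killed K e n 0 0)))) \<longlonglongrightarrow> Re J"
    by (intro tendsto_Re) auto
  then have "(\<lambda>N. (1/(2*pi)) * (2 * pi * (\<Sum>n<N. s ^ n * killed K e n 0 0))) \<longlonglongrightarrow> (1/(2*pi)) * Re J"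
    by (intro tendsto_mult_left) simp
  then have **: "(\<lambda>n. s ^ n * killed K e n 0 0) sums (Re J / (2 * pi))" by (simp add: sums_def)
  then show "summable (\<lambda>n. s ^ n * killed K e n 0 0)" by (rule sums_summable)
  have "((\<lambda>\<theta>. Re (resolv K e s \<theta> 0)) has_integral Re J) {-pi..pi}"
    using has_integral_linear[OF *(2) bounded_linear_Re] by (simp add: o_def)
  then show "((\<lambda>\<theta>. Re (resolv K e s \<theta> 0)) has_integral (2 * pi * (\<Sum>n. s ^ n * killed K e n 0 0))) {-pi..pi}"
    by (simp flip: sums_unique[OF **])
qed

section \<open>The resolvent equation and its energy identity\<close>

lemma sum_int_shift: 
  fixes h :: "int \<Rightarrow> 'a::comm_monoid_add" 
  shows "(\<Sum>y\<in>{a..b}. h (y + k)) = (\<Sum>y\<in>{a+k..b+k}. h y)"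
  by (rule sum.reindex_bij_witness[of _ "\<lambda>y. y - k" "\<lambda>y. y + k"]) auto

lemma sum_by_parts:
  fixes g V :: "int \<Rightarrow> complex"
  assumes "a \<le> b + 1" "g (a - 1) = 0" "g (b + 1) = 0"
  shows "(\<Sum>y\<in>{a..b}. g y * (2 * V y - V (y+1) - V (y-1))) = (\<Sum>y\<in>{a-1..b}. (g (y+1) - g y) * (V (y+1) - V y))"
proof -
  have sp: "{a-1..b} = insert (a-1) {a..b}" "{a..b+1} = insert (b+1) {a..b}" using assms(1) by auto
  have "(\<Sum>y\<in>{a-1..b}. (g (y+1) - g y) * (V (y+1) - V y))
      = (\<Sum>y\<in>{a-1..b}. g (y+1) * (V (y+1) - V ((y+1)-1))) - (\<Sum>y\<in>{a-1..b}. g y * (V (y+1) - V y))"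
    by (simp add: sum_subtractf[symmetric] algebra_simps)
  also have "(\<Sum>y\<in>{a-1..b}. g (y+1) * (V (y+1) - V ((y+1)-1))) = (\<Sum>y\<in>{a..b+1}. g y * (V y - V (y-1)))"
    using sum_int_shift[of "\<lambda>y. g y * (V y - V (y-1))" 1 "a-1" b] by simp
  also have "\<dots> = (\<Sum>y\<in>{a..b}. g y * (V y - V (y-1)))" unfolding sp(2) using assms by (subst sum.insert) auto
  also have "(\<Sum>y\<in>{a-1..b}. g y * (V (y+1) - V y)) = (\<Sum>y\<in>{a..b}. g y * (V (y+1) - V y))"
    unfolding sp(1) using assms by (subst sum.insert) auto
  finally show ?thesis by (simp add: sum_subtractf[symmetric] algebra_simps)
qed

lemma norm_sum_cs:
  fixes z :: "'i \<Rightarrow> complex" and x :: "'i \<Rightarrow> real"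
  shows "(norm (\<Sum>i\<in>I. of_real (x i) * z i))\<^sup>2 \<le> (\<Sum>i\<in>I. (x i)\<^sup>2) * (\<Sum>i\<in>I. (norm (z i))\<^sup>2)"
proof -
  have "norm (\<Sum>i\<in>I. of_real (x i) * z i) \<le> (\<Sum>i\<in>I. \<bar>x i\<bar> * norm (z i))"
    by (rule order_trans[OF norm_sum]) (simp add: norm_mult)
  then have "(norm (\<Sum>i\<in>I. of_real (x i) * z i))\<^sup>2 \<le> (\<Sum>i\<in>I. \<bar>x i\<bar> * norm (z i))\<^sup>2"
    by (intro power_mono) auto
  also have "\<dots> \<le> (\<Sum>i\<in>I. \<bar>x i\<bar>\<^sup>2) * (\<Sum>i\<in>I. (norm (z i))\<^sup>2)" by (rule Cauchy_Schwarz_ineq_sum)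
  finally show ?thesis by simp
qed

text \<open>After multiplication by the conjugate of \<open>V\<close>, the drift term \<open>\<i> sin \<theta> e y\<close> is purely imaginary, so the
  real part of \<open>V 0\<close> is a Dirichlet energy in which the environment does not appear (lemma \<open>energy\<close>).
  The environment enters only through tests of the equation against other functions (lemma \<open>tested\<close>).\<close>

locale resolvent =
  fixes K :: int and e :: "int \<Rightarrow> int" and s \<theta> :: real and V :: "int \<Rightarrow> complex"
  assumes K: "0 \<le> K" and s: "1/2 \<le> s" "s < 1" and e: "\<And>y. e y \<in> {-1, 1}"
    and outside: "\<And>y. \<bar>y\<bar> > K \<Longrightarrow> V y = 0"
    and eqn0: "\<And>y. \<bar>y\<bar> \<le> K \<Longrightarrow> V y = (if y = 0 then 1 else 0) + of_real (s / 3) *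
       (V (y+1) + V (y-1) + cis (- (\<theta> * real_of_int (e y))) * V y)"
begin

text \<open>The real diagonal coefficient \<open>1 - s / 3 * cos \<theta>\<close> minus the
  \<open>2 * s / 3\<close> that goes into the discrete Laplacian. It stays positive at
  \<open>\<theta> = 0\<close> because of the weight \<open>s < 1\<close>. The sum in
  \<open>D\<close> includes the two edges leaving the strip.\<close>

definition "mass = (1 - s) + s / 3 * (1 - cos \<theta>)"
definition "A = (\<Sum>y\<in>{-K..K}. (norm (V y))\<^sup>2)"
definition "D = (\<Sum>y\<in>{-K-1..K}. (norm (V (y+1) - V y))\<^sup>2)"
definition "E = Re (V 0)"

lemma eqn:
  assumes "\<bar>y\<bar> \<le> K"
  shows "of_real mass * V y + of_real (s/3) * (2 * V y - V (y+1) - V (y-1))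
    + of_real (s/3 * sin \<theta>) * \<i> * (of_int (e y) * V y) = (if y = 0 then 1 else 0)"
proof -
  have "cis (- (\<theta> * real_of_int (e y))) = of_real (cos \<theta>) - \<i> * of_int (e y) * of_real (sin \<theta>)"
    using e[of y] by (auto simp: complex_eq_iff)
  note c = this
  have "of_real mass * V y + of_real (s/3) * (2 * V y - V (y+1) - V (y-1))
    + of_real (s/3 * sin \<theta>) * \<i> * (of_int (e y) * V y)
    = V y - of_real (s / 3) * (V (y+1) + V (y-1) + cis (- (\<theta> * real_of_int (e y))) * V y)"
    unfolding c mass_def by (simp add: field_simps)
  moreover have "V y - of_real (s / 3) * (V (y+1) + V (y-1) + cis (- (\<theta> * real_of_int (e y))) * V y) = (if y = 0 then 1 else 0)"
    by (subst (1) eqn0[OF assms]) simp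
  ultimately show ?thesis by simp
qed

lemma tested:
  fixes g :: "int \<Rightarrow> complex"
  assumes "-K \<le> a" "b \<le> K" "a \<le> b + 1" "g (a-1) = 0" "g (b+1) = 0"
  shows "of_real mass * (\<Sum>y\<in>{a..b}. g y * V y) + of_real (s/3) * (\<Sum>y\<in>{a-1..b}. (g (y+1) - g y) * (V (y+1) - V y))
    + of_real (s/3 * sin \<theta>) * \<i> * (\<Sum>y\<in>{a..b}. of_int (e y) * (g y * V y)) = (if 0 \<in> {a..b} then g 0 else 0)"
proof -
  have "(if 0 \<in> {a..b} then g 0 else 0) = (\<Sum>y\<in>{a..b}. g y * (if y = 0 then 1 else 0))"
    by (simp add: if_distrib sum.delta cong: if_cong)
  also have "\<dots> = (\<Sum>y\<in>{a..b}. g y * (of_real mass * V y + of_real (s/3) * (2 * V y - V (y+1) - V (y-1))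
    + of_real (s/3 * sin \<theta>) * \<i> * (of_int (e y) * V y)))"
    by (intro sum.cong refl arg_cong2[where f="(*)"] eqn[symmetric]) (use assms in auto)
  also have "\<dots> = of_real mass * (\<Sum>y\<in>{a..b}. g y * V y) + of_real (s/3) * (\<Sum>y\<in>{a..b}. g y * (2 * V y - V (y+1) - V (y-1)))
    + of_real (s/3 * sin \<theta>) * \<i> * (\<Sum>y\<in>{a..b}. of_int (e y) * (g y * V y))"
    unfolding sum_distrib_left sum.distrib[symmetric] by (intro sum.cong refl) (simp only: algebra_simps)
  finally show ?thesis using sum_by_parts[of a b g V] assms by simp
qed

lemma energy: "E = mass * A + s/3 * D"
proof -
  have "of_real mass * (\<Sum>y\<in>{-K..K}. cnj (V y) * V y) + of_real (s/3) * (\<Sum>y\<in>{-K-1..K}. (cnj (V (y+1)) - cnj (V y)) * (V (y+1) - V y))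
    + of_real (s/3 * sin \<theta>) * \<i> * (\<Sum>y\<in>{-K..K}. of_int (e y) * (cnj (V y) * V y)) = cnj (V 0)"
    using tested[of "-K" K "\<lambda>y. cnj (V y)"] K by (simp add: outside)
  then have eq: "complex_of_real mass * of_real A + of_real (s/3) * of_real D
    + of_real (s/3 * sin \<theta>) * \<i> * of_real (\<Sum>y\<in>{-K..K}. of_int (e y) * (norm (V y))\<^sup>2) = cnj (V 0)"
    unfolding A_def D_def of_real_sum by (simp add: complex_norm_square[symmetric] mult.commute flip: complex_cnj_diff of_real_power)
  show ?thesis using arg_cong[OF eq, of Re] by (simp add: E_def)
qed

lemma A_nonneg: "0 \<le> A" and D_nonneg: "0 \<le> D" by (simp_all add: A_def D_def sum_nonneg)

lemma mass_pos: "0 < mass" unfolding mass_def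
  using s by (intro add_pos_nonneg mult_nonneg_nonneg) auto

lemma E_nonneg: "0 \<le> E" using energy mass_pos A_nonneg D_nonneg s by (simp)

text \<open>Here \<open>1/2 \<le> s\<close> enters: the gradient term of the energy has coefficient
  \<open>s / 3 \<ge> 1/6\<close>.\<close>

lemma D_le: "D \<le> 6 * E"
proof -
  have "s/3 * D \<le> E" using energy mass_pos A_nonneg by simp
  moreover have "1/6 * D \<le> s/3 * D" using s D_nonneg by (intro mult_right_mono) auto
  ultimately show ?thesis by simp
qed

lemma mass_A_le: "mass * A \<le> E" using energy D_nonneg s by simp

lemma E_le_norm: "E \<le> norm (V 0)" unfolding E_def by (rule complex_Re_le_cmod)

lemma norm_V0_le: "(norm (V 0))\<^sup>2 \<le> A"
  unfolding A_def using K by (intro member_le_sum) auto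

text \<open>The chain \<open>E^2 \<le> (norm (V 0))^2 \<le> A \<le> E / mass\<close>, with one
  factor \<open>E\<close> cancelled. It handles frequencies away from 0, uniformly in the strip and
  in \<open>s\<close>.\<close>

lemma E_le_mass: "mass * E \<le> 1"
proof (cases "E = 0")
  case False
  have "mass * E\<^sup>2 \<le> mass * A" using norm_V0_le E_le_norm E_nonneg mass_pos
    by (intro mult_left_mono) (auto intro: order_trans[OF power_mono])
  also have "\<dots> \<le> E" by (rule mass_A_le)
  finally have "E * (mass * E) \<le> E * 1" by (simp add: power2_eq_square mult_ac)
  then show ?thesis using False E_nonneg by (subst (asm) mult_le_cancel_left_pos) auto
qed auto

lemma telescope: "0 \<le> x \<Longrightarrow> V x - V 0 = (\<Sum>y\<in>{0..<x}. V (y+1) - V y)"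
proof (induction x rule: int_ge_induct)
  case (step i)
  have "{0..<i+1} = insert i {0..<i}" using step by auto
  then show ?case using step.hyps by (simp add: step.IH[symmetric])
qed simp

text \<open>Cauchy-Schwarz on the telescoping sum. The case \<open>x = K + 1\<close>, where
  \<open>V\<close> vanishes, turns this into a bound for \<open>V 0\<close> itself.\<close>

lemma diff_le: 
  assumes "0 \<le> x" "x \<le> K + 1"
  shows "(norm (V x - V 0))\<^sup>2 \<le> of_int x * D"
proof -
  have "(norm (V x - V 0))\<^sup>2 \<le> (\<Sum>y\<in>{0..<x}. 1\<^sup>2) * (\<Sum>y\<in>{0..<x}. (norm (V (y+1) - V y))\<^sup>2)"
    using norm_sum_cs[of "\<lambda>_. 1" "\<lambda>y. V (y+1) - V y" "{0..<x}"] telescope[OF assms(1)] by simp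
  also have "\<dots> \<le> (\<Sum>y\<in>{0..<x}. 1\<^sup>2) * D"
    unfolding D_def using assms K by (intro mult_left_mono sum_mono2) auto
  finally show ?thesis using assms by simp
qed

text \<open>Comes from the zero boundary value alone and so holds at every frequency, including
  those that are too small compared with \<open>1 - s\<close> for the other estimates.\<close>

lemma E_le_K: "E \<le> 6 * (K + 1)"
proof (cases "E = 0")
  case False
  have "(norm (V 0))\<^sup>2 \<le> of_int (K+1) * D" using diff_le[of "K+1"] K outside[of "K+1"] by simp
  then have "E\<^sup>2 \<le> of_int (K+1) * D" using E_le_norm E_nonneg by (auto intro: order_trans[OF power_mono])
  also have "\<dots> \<le> of_int (K+1) * (6 * E)" using D_le K by (intro mult_left_mono) auto
  finally have "E * E \<le> E * (6 * (K+1))" by (simp add: power2_eq_square mult_ac)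
  then show ?thesis using False E_nonneg by (subst (asm) mult_le_cancel_left_pos) auto
next
  case True
  then show ?thesis using K by simp
qed

end

lemma resolvent_resolv:
  assumes "0 \<le> K" "1/2 \<le> s" "s < 1" "\<And>y. e y \<in> {-1, 1}"
  shows "resolvent K e s \<theta> (resolv K e s \<theta>)"
proof
  show "resolv K e s \<theta> y = (if y = 0 then 1 else 0) + of_real (s / 3) *
       (resolv K e s \<theta> (y+1) + resolv K e s \<theta> (y-1) + cis (- (\<theta> * real_of_int (e y))) * resolv K e s \<theta> y)"
    if "\<bar>y\<bar> \<le> K" for y by (rule resolv_eqn) (use assms that in auto)
qed (use assms in \<open>auto simp: resolv_outside\<close>)

section \<open>Energy estimates\<close>

lemma sin_ge_half: "0 \<le> x \<Longrightarrow> x \<le> 1 \<Longrightarrow> x / 2 \<le> sin (x::real)"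
proof -
  assume x: "0 \<le> x" "x \<le> 1"
  have "sin 0 - 0 / 2 \<le> sin x - x / 2"
  proof (rule DERIV_nonneg_imp_nondecreasing[OF x(1)])
    fix t assume t: "0 \<le> t" "t \<le> x"
    have "cos (pi / 3) \<le> cos t"
      using t x pi_gt3 by (intro cos_monotone_0_pi_le) auto
    then have "0 \<le> cos t - 1 / 2" by (simp add: cos_60)
    then show "\<exists>y. ((\<lambda>x. sin x - x / 2) has_real_derivative y) (at t) \<and> 0 \<le> y"
      by (intro exI[of _ "cos t - 1/2"]) (auto intro!: derivative_eq_intros)
  qed
  then show ?thesis by simp
qed

lemma sin_sq_bounds:
  fixes \<theta> :: real
  assumes "\<bar>\<theta>\<bar> \<le> 1"
  shows "\<theta>\<^sup>2 / 4 \<le> (sin \<theta>)\<^sup>2" "(sin \<theta>)\<^sup>2 \<le> \<theta>\<^sup>2" "\<theta>\<^sup>2 / 8 \<le> 1 - cos \<theta>" "1 - cos \<theta> \<le> \<theta>\<^sup>2"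
proof -
  have lo: "(x / 2)\<^sup>2 \<le> (sin x)\<^sup>2" if "\<bar>x\<bar> \<le> 1" for x :: real
    using sin_ge_half[of "\<bar>x\<bar>"] that by (cases "0 \<le> x") (auto simp: abs_le_square_iff[symmetric])
  have hi: "(sin x)\<^sup>2 \<le> x\<^sup>2" for x :: real
    using abs_sin_x_le_abs_x[of x] by (simp add: abs_le_square_iff)
  have c: "1 - cos \<theta> = 2 * (sin (\<theta>/2))\<^sup>2" using cos_double_sin[of "\<theta>/2"] by simp
  show "\<theta>\<^sup>2 / 4 \<le> (sin \<theta>)\<^sup>2" "(sin \<theta>)\<^sup>2 \<le> \<theta>\<^sup>2" using lo[OF assms] hi by (auto simp: power_divide)
  show "\<theta>\<^sup>2 / 8 \<le> 1 - cos \<theta>" "1 - cos \<theta> \<le> \<theta>\<^sup>2"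
    unfolding c using lo[of "\<theta>/2"] hi[of "\<theta>/2"] assms by (auto simp: power_divide)
qed

lemma norm_add2_sq: "(norm (a + b :: complex))\<^sup>2 \<le> 2 * ((norm a)\<^sup>2 + (norm b)\<^sup>2)"
proof -
  have "(norm (a + b))\<^sup>2 \<le> (norm a + norm b)\<^sup>2" by (intro power_mono norm_triangle_ineq) auto
  also have "\<dots> \<le> 2 * ((norm a)\<^sup>2 + (norm b)\<^sup>2)"
    using sum_squares_bound[of "norm a" "norm b"] by (simp add: power2_sum)
  finally show ?thesis .
qed

lemma norm_add3_sq: "(norm (a + b + c :: complex))\<^sup>2 \<le> 3 * ((norm a)\<^sup>2 + (norm b)\<^sup>2 + (norm c)\<^sup>2)"
proof -
  have "norm (a + b + c) \<le> norm a + norm b + norm c"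
    using norm_triangle_ineq[of "a+b" c] norm_triangle_ineq[of a b] by linarith
  then have "(norm (a + b + c))\<^sup>2 \<le> (norm a + norm b + norm c)\<^sup>2" by (intro power_mono) auto
  also have "\<dots> \<le> 3 * ((norm a)\<^sup>2 + (norm b)\<^sup>2 + (norm c)\<^sup>2)"
    using sum_squares_bound[of "norm a" "norm b"] sum_squares_bound[of "norm a" "norm c"] sum_squares_bound[of "norm b" "norm c"]
    by (simp add: power2_eq_square algebra_simps)
  finally show ?thesis .
qed

lemma sum_diff_by_parts:
  fixes S :: "int \<Rightarrow> real" and h :: "int \<Rightarrow> complex"
  assumes "a \<le> b + 1" "h (a - 1) = 0" "h (b + 1) = 0"
  shows "(\<Sum>y\<in>{a..b}. of_real (S y - S (y-1)) * h y) = - (\<Sum>y\<in>{a-1..b}. of_real (S y) * (h (y+1) - h y))"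
proof -
  have sp: "{a-1..b} = insert (a-1) {a..b}" "{a..b+1} = insert (b+1) {a..b}" using assms(1) by auto
  have "(\<Sum>y\<in>{a-1..b}. of_real (S y) * h (y+1)) = (\<Sum>y\<in>{a..b+1}. of_real (S (y-1)) * h y)"
    using sum_int_shift[of "\<lambda>y. of_real (S (y-1)) * h y" 1 "a-1" b] by simp
  also have "\<dots> = (\<Sum>y\<in>{a..b}. of_real (S (y-1)) * h y)" unfolding sp(2) using assms by (subst sum.insert) auto
  finally have 1: "(\<Sum>y\<in>{a-1..b}. of_real (S y) * h (y+1)) = (\<Sum>y\<in>{a..b}. of_real (S (y-1)) * h y)" .
  have 2: "(\<Sum>y\<in>{a-1..b}. of_real (S y) * h y) = (\<Sum>y\<in>{a..b}. of_real (S y) * h y)"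
    unfolding sp(1) using assms by (subst sum.insert) auto
  show ?thesis by (simp add: right_diff_distrib left_diff_distrib sum_subtractf 1 2)
qed

section \<open>Lower bound for the energy from bounded partial sums of the orientations\<close>

context resolvent
begin

text \<open>The condition \<open>1 - s \<le> \<theta>^2\<close> says that the killing by
  \<open>s\<close> does not exceed the natural mass of the frequency.\<close>

lemma mass_le: 
  assumes "\<bar>\<theta>\<bar> \<le> 1" "1 - s \<le> \<theta>\<^sup>2" shows "mass \<le> 2 * \<theta>\<^sup>2"
proof -
  have "s / 3 * (1 - cos \<theta>) \<le> 1 * \<theta>\<^sup>2"
    using s sin_sq_bounds[OF assms(1)] by (intro mult_mono) auto
  then show ?thesis unfolding mass_def using assms by simp
qed

lemma mass_ge: "1 - cos \<theta> \<le> 6 * mass"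
proof -
  have "1 * (1 - cos \<theta>) \<le> (2 * s) * (1 - cos \<theta>)" using s by (intro mult_right_mono) auto
  then have "1 - cos \<theta> \<le> 6 * (s / 3 * (1 - cos \<theta>))" by simp
  also have "\<dots> \<le> 6 * mass" unfolding mass_def using s by (intro mult_left_mono) auto
  finally show ?thesis .
qed

text \<open>At width \<open>L\<close> of order \<open>1 / \<theta>\<close> all errors scale alike.
  Their squares are of order \<open>mass^2 * L * A\<close>, \<open>D / L\<close>,
  \<open>\<theta>^2 * C^2 * L * D\<close> and \<open>\<theta>^2 * C^2 * A / L\<close>; as
  \<open>mass\<close> is of order \<open>\<theta>^2\<close>, \<open>mass * A \<le> E\<close> and
  \<open>D \<le> 6 * E\<close>, each is at most a constant times \<open>C^2 * \<theta> * E\<close>.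
  The source term is the height 1 of the tent.\<close>

lemma E_lower_bound:
  fixes S :: "int \<Rightarrow> real" and L :: int and C :: real
  assumes S: "\<And>y. S y - S (y-1) = e y" "\<And>y. \<bar>S y\<bar> \<le> C" and C: "1 \<le> C"
    and \<theta>: "0 < \<theta>" "\<theta> \<le> 1" "1 - s \<le> \<theta>\<^sup>2" and L: "1 \<le> L" "L \<le> K" "1 / \<theta> \<le> L" "L \<le> 2 / \<theta>"
  shows "1 \<le> 140 * C\<^sup>2 * \<theta> * E"
proof -
  define gr :: "int \<Rightarrow> real" where "gr y = max 0 (1 - \<bar>y\<bar> / L)" for y
  define g where "g y = complex_of_real (gr y)" for y
  have gr01: "0 \<le> gr y" "gr y \<le> 1" for y using L by (auto simp: gr_def)
  have gr0: "gr y = 0" if "\<bar>y\<bar> \<ge> L" for y using that L by (auto simp: gr_def field_simps)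
  have dgr: "\<bar>gr (y+1) - gr y\<bar> \<le> 1 / L" for y
  proof -
    have "\<bar>real_of_int \<bar>y+1\<bar> / L - real_of_int \<bar>y\<bar> / L\<bar> \<le> 1 / L"
      using L by (auto simp: abs_le_iff divide_simps)
    moreover have "0 \<le> 1 / real_of_int L" using L by simp
    ultimately show ?thesis unfolding gr_def max_def of_int_abs by argo
  qed
  have cardL: "real (card {-L..L-1}) = 2 * L" using L by auto
  have G1: "(\<Sum>y\<in>X. (gr (y+k))\<^sup>2) \<le> 3 * L" if "finite X" for X k
  proof -
    have "(\<Sum>y\<in>X. (gr (y+k))\<^sup>2) \<le> (\<Sum>y\<in>X. of_bool (y \<in> {-L-k..L-k}))"
      using gr01 gr0 by (intro sum_mono) (auto simp: power_le_one_iff)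
    also have "\<dots> = real (card (X \<inter> {-L-k..L-k}))" using that by (simp add: Int_def)
    also have "\<dots> \<le> real (card {-L-k..L-k})" by (intro of_nat_mono card_mono) auto
    also have "\<dots> \<le> 3 * L" using L by auto
    finally show ?thesis .
  qed
  have G2: "(\<Sum>y\<in>X. (gr (y+1) - gr y)\<^sup>2) \<le> 2 / L" if "finite X" for X
  proof -
    have "(\<Sum>y\<in>X. (gr (y+1) - gr y)\<^sup>2) \<le> (\<Sum>y\<in>X. (1/L)\<^sup>2 * of_bool (y \<in> {-L..L-1}))"
    proof (intro sum_mono)
      fix y
      show "(gr (y+1) - gr y)\<^sup>2 \<le> (1/L)\<^sup>2 * of_bool (y \<in> {-L..L-1})"
        using dgr[of y] gr0[of y] gr0[of "y+1"] L by (auto simp flip: abs_le_square_iff)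
    qed
    also have "\<dots> = (1/L)\<^sup>2 * real (card (X \<inter> {-L..L-1}))" using that by (simp add: sum_distrib_left[symmetric] Int_def)
    also have "\<dots> \<le> (1/L)\<^sup>2 * real (card {-L..L-1})" by (intro mult_left_mono of_nat_mono card_mono) auto
    also have "\<dots> = 2 / L" unfolding cardL using L by (simp add: power2_eq_square)
    finally show ?thesis .
  qed
  have g0: "g (-K-1) = 0" "g (K+1) = 0" using gr0 L by (auto simp: g_def)
  define Z1 where "Z1 = (\<Sum>y\<in>{-K..K}. g y * V y)"
  define Z2 where "Z2 = (\<Sum>y\<in>{-K-1..K}. (g (y+1) - g y) * (V (y+1) - V y))"
  \<comment> \<open>After the drift is summed by parts, the difference of \<open>g * V\<close>
    splits by the discrete product rule into the parts \<open>Z3\<close> and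
    \<open>Z4\<close>.\<close>
  define Z3 where "Z3 = (\<Sum>y\<in>{-K-1..K}. of_real (S y * gr (y+1)) * (V (y+1) - V y))"
  define Z4 where "Z4 = (\<Sum>y\<in>{-K-1..K}. of_real (S y * (gr (y+1) - gr y)) * V y)"
  have AV: "(\<Sum>y\<in>{-K-1..K}. (norm (V y))\<^sup>2) = A"
  proof -
    have "{-K-1..K} = insert (-K-1) {-K..K}" using K by auto
    then show ?thesis unfolding A_def by (simp add: outside)
  qed
  have "(\<Sum>y\<in>{-K..K}. of_int (e y) * (g y * V y)) = (\<Sum>y\<in>{-K..K}. of_real (S y - S (y-1)) * (g y * V y))"
    using S(1) by (intro sum.cong refl) (metis of_real_of_int_eq)
  also have "\<dots> = - (\<Sum>y\<in>{-K-1..K}. of_real (S y) * (g (y+1) * V (y+1) - g y * V y))"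
    using K by (subst sum_diff_by_parts) (auto simp: outside)
  also have "\<dots> = - (Z3 + Z4)"
    unfolding Z3_def Z4_def sum.distrib[symmetric] by (simp add: g_def algebra_simps)
  finally have 3: "(\<Sum>y\<in>{-K..K}. of_int (e y) * (g y * V y)) = - (Z3 + Z4)" .
  have "of_real mass * Z1 + of_real (s/3) * Z2 + of_real (s/3 * sin \<theta>) * \<i> * (- (Z3 + Z4)) = g 0"
    using tested[of "-K" K g] K g0 unfolding Z1_def Z2_def 3[symmetric] by simp
  moreover have "g 0 = 1" by (simp add: g_def gr_def)
  ultimately have one: "1 = (of_real mass * Z1 + of_real (s/3) * Z2) + (of_real (s/3 * sin \<theta>) * (- \<i> * Z3) + of_real (s/3 * sin \<theta>) * (- \<i> * Z4))"
    by (simp only: mult.assoc minus_add_distrib distrib_left mult_minus_left mult_minus_right)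
  have z1: "(norm Z1)\<^sup>2 \<le> 3 * L * A"
  proof -
    have "(\<Sum>y\<in>{-K..K}. (gr y)\<^sup>2) \<le> 3 * L" using G1[of "{-K..K}" 0] by simp
    then show ?thesis unfolding Z1_def g_def A_def
      by (intro order_trans[OF norm_sum_cs] mult_right_mono) (auto intro: sum_nonneg)
  qed
  have z2: "(norm Z2)\<^sup>2 \<le> 2 / L * D"
    unfolding Z2_def g_def D_def of_real_diff[symmetric]
    by (intro order_trans[OF norm_sum_cs] mult_right_mono G2) (auto intro: sum_nonneg)
  have S2: "(S y)\<^sup>2 \<le> C\<^sup>2" for y using S(2)[of y] C by (simp flip: abs_le_square_iff)
  have z3: "(norm Z3)\<^sup>2 \<le> C\<^sup>2 * (3 * L) * D"
  proof -
    have "(\<Sum>y\<in>{-K-1..K}. (S y * gr (y+1))\<^sup>2) \<le> C\<^sup>2 * (\<Sum>y\<in>{-K-1..K}. (gr (y+1))\<^sup>2)"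
      unfolding sum_distrib_left power_mult_distrib using S2 by (intro sum_mono mult_right_mono) auto
    also have "\<dots> \<le> C\<^sup>2 * (3 * L)" using G1 by (intro mult_left_mono) auto
    finally show ?thesis unfolding Z3_def D_def
      by (intro order_trans[OF norm_sum_cs] mult_right_mono) (auto intro!: sum_nonneg)
  qed
  have z4: "(norm Z4)\<^sup>2 \<le> C\<^sup>2 * (2 / L) * A"
  proof -
    have "(\<Sum>y\<in>{-K-1..K}. (S y * (gr (y+1) - gr y))\<^sup>2) \<le> C\<^sup>2 * (\<Sum>y\<in>{-K-1..K}. (gr (y+1) - gr y)\<^sup>2)"
      unfolding sum_distrib_left power_mult_distrib using S2 by (intro sum_mono mult_right_mono) auto
    also have "\<dots> \<le> C\<^sup>2 * (2 / L)" using G2 by (intro mult_left_mono) auto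
    finally show ?thesis unfolding Z4_def AV[symmetric]
      by (intro order_trans[OF norm_sum_cs] mult_right_mono) (auto intro!: sum_nonneg)
  qed
  have "1 = (norm (1::complex))\<^sup>2" by simp
  also have "\<dots> \<le> 4 * (mass\<^sup>2 * (norm Z1)\<^sup>2 + (s/3)\<^sup>2 * (norm Z2)\<^sup>2 + (s/3 * sin \<theta>)\<^sup>2 * (norm Z3)\<^sup>2 + (s/3 * sin \<theta>)\<^sup>2 * (norm Z4)\<^sup>2)"
    using norm_add2_sq[of "of_real mass * Z1 + of_real (s/3) * Z2" "of_real (s/3 * sin \<theta>) * (- \<i> * Z3) + of_real (s/3 * sin \<theta>) * (- \<i> * Z4)"]
      norm_add2_sq[of "of_real mass * Z1" "of_real (s/3) * Z2"] norm_add2_sq[of "of_real (s/3 * sin \<theta>) * (- \<i> * Z3)" "of_real (s/3 * sin \<theta>) * (- \<i> * Z4)"]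
    unfolding one[symmetric] norm_mult power_mult_distrib norm_minus_cancel norm_ii norm_of_real power2_abs by simp
  finally have main: "1 \<le> 4 * (mass\<^sup>2 * (norm Z1)\<^sup>2 + (s/3)\<^sup>2 * (norm Z2)\<^sup>2 + (s/3 * sin \<theta>)\<^sup>2 * (norm Z3)\<^sup>2 + (s/3 * sin \<theta>)\<^sup>2 * (norm Z4)\<^sup>2)" .
  have abs1: "\<bar>\<theta>\<bar> \<le> 1" using \<theta> by simp
  have kapu: "mass \<le> 2 * \<theta>\<^sup>2" by (rule mass_le) (use abs1 \<theta> in auto)
  have kapl: "\<theta>\<^sup>2 / 48 \<le> mass" using mass_ge sin_sq_bounds(3)[OF abs1] by linarith
  have s2: "(s/3)\<^sup>2 \<le> 1/9" using s by (simp add: power_divide power_le_one)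
  have ss: "(s/3 * sin \<theta>)\<^sup>2 \<le> 1/9 * \<theta>\<^sup>2" unfolding power_mult_distrib
    using s2 sin_sq_bounds(2)[OF abs1] by (intro mult_mono) auto
  have E0: "0 \<le> E" by (rule E_nonneg)
  have iL: "2 / L \<le> 2 * \<theta>" using L \<theta> by (simp add: field_simps)
  have hL: "3 * L \<le> 6 / \<theta>" using L by simp
  have hA: "\<theta>\<^sup>2 * A \<le> 48 * E"
    using mult_right_mono[OF kapl A_nonneg] mass_A_le by simp
  have b1: "mass\<^sup>2 * (norm Z1)\<^sup>2 \<le> 12 * \<theta> * E"
  proof -
    have "mass\<^sup>2 * (norm Z1)\<^sup>2 \<le> mass\<^sup>2 * (3 * L * A)" using z1 by (intro mult_left_mono) auto
    also have "\<dots> = mass * (3 * L) * (mass * A)" by (simp add: power2_eq_square)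
    also have "\<dots> \<le> (2 * \<theta>\<^sup>2) * (6 / \<theta>) * E"
      using kapu hL mass_A_le mass_pos L A_nonneg \<theta> by (intro mult_mono) auto
    also have "\<dots> = 12 * \<theta> * E" using \<theta> by (simp add: power2_eq_square)
    finally show ?thesis .
  qed
  have b2: "(s/3)\<^sup>2 * (norm Z2)\<^sup>2 \<le> 2 * \<theta> * E"
  proof -
    have "(s/3)\<^sup>2 * (norm Z2)\<^sup>2 \<le> 1/9 * (2 * \<theta> * (6 * E))"
      using s2 z2 iL D_le D_nonneg \<theta> L E0
      by (intro mult_mono order_trans[OF z2]) auto
    also have "\<dots> \<le> 2 * \<theta> * E" using E0 \<theta> by simp
    finally show ?thesis .
  qed
  have b3: "(s/3 * sin \<theta>)\<^sup>2 * (norm Z3)\<^sup>2 \<le> 4 * C\<^sup>2 * \<theta> * E"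
  proof -
    have "(s/3 * sin \<theta>)\<^sup>2 * (norm Z3)\<^sup>2 \<le> (1/9 * \<theta>\<^sup>2) * (C\<^sup>2 * (6 / \<theta>) * (6 * E))"
      using ss hL D_le D_nonneg \<theta> L E0
      by (intro mult_mono order_trans[OF z3]) auto
    also have "\<dots> = 4 * C\<^sup>2 * \<theta> * E" using \<theta> by (simp add: power2_eq_square)
    finally show ?thesis .
  qed
  have b4: "(s/3 * sin \<theta>)\<^sup>2 * (norm Z4)\<^sup>2 \<le> 16 * C\<^sup>2 * \<theta> * E"
  proof -
    have "(s/3 * sin \<theta>)\<^sup>2 * (norm Z4)\<^sup>2 \<le> (1/9 * \<theta>\<^sup>2) * (C\<^sup>2 * (2 * \<theta>) * A)"
      using ss iL A_nonneg \<theta> L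
      by (intro mult_mono order_trans[OF z4]) auto
    also have "\<dots> = (C\<^sup>2 * \<theta> * 2 / 9) * (\<theta>\<^sup>2 * A)" by simp
    also have "\<dots> \<le> (C\<^sup>2 * \<theta> * 2 / 9) * (48 * E)" using hA \<theta> by (intro mult_left_mono) auto
    also have "\<dots> \<le> 16 * C\<^sup>2 * \<theta> * E" using E0 \<theta> by (simp add: mult_nonneg_nonneg)
    finally show ?thesis .
  qed
  \<comment> \<open>By \<open>1 \<le> C\<close>, the contributions \<open>12 + 2\<close> that lack
    the factor \<open>C^2\<close> join \<open>4 + 16\<close>, and
    \<open>4 * 34 \<le> 140\<close>.\<close>
  have "\<theta> * E * 1 \<le> \<theta> * E * C\<^sup>2" using C E0 \<theta> by (intro mult_left_mono) (auto simp: one_le_power)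
  then have "14 * (\<theta> * E) \<le> 14 * (C\<^sup>2 * \<theta> * E)" by (simp add: mult_ac)
  with main b1 b2 b3 b4 have "1 \<le> 4 * (34 * (C\<^sup>2 * \<theta> * E))" by (simp add: mult_ac)
  also have "\<dots> \<le> 140 * C\<^sup>2 * \<theta> * E" using \<theta> E0 by simp
  finally show ?thesis .
qed

end

section \<open>Upper bound for the energy from weighted sums over blocks\<close>

lemma sum_abel_tail:
  fixes V :: "int \<Rightarrow> complex" and c :: "int \<Rightarrow> complex"
  assumes "a \<le> m"
  shows "(\<Sum>x\<in>{a..m}. c x * V x) = V a * (\<Sum>x\<in>{a..m}. c x)
     + (\<Sum>y\<in>{a..m}. (\<Sum>x\<in>{y+1..m}. c x) * (V (y+1) - V y))"
  using assms
proof (induction m rule: int_ge_induct)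
  case (step m)
  have i: "{k..m+1} = insert (m+1) {k..m}" if "k \<le> m + 1" for k using that by auto
  have tel: "(\<Sum>y\<in>{a..m}. V (y+1) - V y) = V (m+1) - V a"
    using step.hyps
  proof (induction m rule: int_ge_induct)
    case (step m)
    have "{a..m+1} = insert (m+1) {a..m}" using step.hyps by auto
    then show ?case using step.IH by (simp add: add.assoc)
  qed simp
  \<comment> \<open>The last summand carries an empty tail, so the value of \<open>V\<close> beyond
    the right end never enters.\<close>
  have "(\<Sum>y\<in>{a..m+1}. (\<Sum>x\<in>{y+1..m+1}. c x) * (V (y+1) - V y))
     = (\<Sum>y\<in>{a..m}. (\<Sum>x\<in>{y+1..m+1}. c x) * (V (y+1) - V y))"
    using i[of a] step.hyps by simp
  also have "\<dots> = (\<Sum>y\<in>{a..m}. c (m+1) * (V (y+1) - V y) + (\<Sum>x\<in>{y+1..m}. c x) * (V (y+1) - V y))"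
    by (intro sum.cong refl) (auto simp: i distrib_right)
  also have "\<dots> = c (m+1) * (V (m+1) - V a) + (\<Sum>y\<in>{a..m}. (\<Sum>x\<in>{y+1..m}. c x) * (V (y+1) - V y))"
    by (simp add: sum.distrib sum_distrib_left[symmetric] tel)
  finally show ?case using step.IH i[of a] step.hyps by (simp add: algebra_simps)
qed simp

text \<open>A parabola rather than a tent, because its sum of squares has a closed form (\<open>sum_sq_parabola\<close>).\<close>

definition bump :: "int \<Rightarrow> nat \<Rightarrow> int \<Rightarrow> real" where
  "bump a n y = of_int ((y - a) * (a + int n - y)) / (real n)\<^sup>2"

lemma bump_bounds:
  assumes "0 < n" "a \<le> y" "y \<le> a + int n"
  shows "0 \<le> bump a n y" "bump a n y \<le> 1"
proof -
  have "(y - a) * (a + int n - y) \<le> int n * int n" using assms by (intro mult_mono) auto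
  then have "real_of_int ((y - a) * (a + int n - y)) \<le> real_of_int (int n * int n)" by (rule of_int_le_iff[THEN iffD2])
  then show "bump a n y \<le> 1" unfolding bump_def using assms by (simp add: power2_eq_square)
  show "0 \<le> bump a n y" unfolding bump_def using assms by auto
qed

lemma bump_diff:
  assumes "0 < n" "a \<le> y" "y < a + int n"
  shows "\<bar>bump a n (y+1) - bump a n y\<bar> \<le> 1 / n"
proof -
  have eq: "bump a n (y+1) - bump a n y = of_int (int n - 2 * (y - a) - 1) / (real n)\<^sup>2"
    unfolding bump_def by (simp add: diff_divide_distrib[symmetric] algebra_simps)
  have "\<bar>int n - 2 * (y - a) - 1\<bar> \<le> int n" using assms by auto
  then have "real_of_int \<bar>int n - 2 * (y - a) - 1\<bar> \<le> real n" by linarith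
  then have "\<bar>bump a n (y+1) - bump a n y\<bar> \<le> real n / (real n)\<^sup>2"
    unfolding eq abs_divide using assms by (intro divide_mono) auto
  also have "\<dots> = 1 / n" using assms by (simp add: power2_eq_square)
  finally show ?thesis .
qed

definition block :: "int \<Rightarrow> nat \<Rightarrow> int set" where "block a n = {a..a + int n - 1}"

text \<open>Sums are taken up to the right end so that Abel summation anchors \<open>V\<close> at
  the left end \<open>a\<close>; the value at \<open>y = a\<close> is the full weighted sum.\<close>

definition tailsum :: "(int \<Rightarrow> int) \<Rightarrow> int \<Rightarrow> nat \<Rightarrow> int \<Rightarrow> real" where
  "tailsum e a n y = (\<Sum>x\<in>{y..a + int n - 1}. of_int (e x) * bump a n x)"

context resolvent
begin

text \<open>The test function does not see the source, so the drift sum \<open>Z\<close> is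
  expressed through the mass and gradient terms and is small. By Abel summation \<open>Z\<close> is
  \<open>V a\<close> times the full weighted sum plus gradients, and \<open>V a\<close> differs from
  \<open>V 0\<close> by at most the root of \<open>a * D\<close>. What remains is \<open>V 0\<close>
  times the weighted sum.\<close>

lemma block_bound:
  assumes n: "0 < n" and a: "0 \<le> a" "a + int n \<le> K" and sin0: "sin \<theta> \<noteq> 0"
    and M: "\<And>y. y \<in> block a n \<Longrightarrow> \<bar>tailsum e a n (y+1)\<bar> \<le> M"
  shows "(E * tailsum e a n a)\<^sup>2 \<le> 3 * (72 * mass\<^sup>2 * n / (sin \<theta>)\<^sup>2 * (\<Sum>y\<in>block a n. (norm (V y))\<^sup>2)
     + (2 / (n * (sin \<theta>)\<^sup>2) + M\<^sup>2 * n) * (\<Sum>y\<in>block a n. (norm (V (y+1) - V y))\<^sup>2)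
     + a * D * (tailsum e a n a)\<^sup>2)"
proof -
  let ?b = "a + int n - 1"
  let ?T = "tailsum e a n a"
  let ?g = "bump a n"
  define AB where "AB = (\<Sum>y\<in>block a n. (norm (V y))\<^sup>2)"
  define DB where "DB = (\<Sum>y\<in>block a n. (norm (V (y+1) - V y))\<^sup>2)"
  define Z where "Z = (\<Sum>y\<in>block a n. of_int (e y) * of_real (?g y) * V y)"
  define Z1 where "Z1 = (\<Sum>y\<in>block a n. of_real (?g y) * V y)"
  define Z2 where "Z2 = (\<Sum>y\<in>block a n. of_real (?g (y+1) - ?g y) * (V (y+1) - V y))"
  have bi: "block a n = insert a {a+1..?b}" using n by (auto simp: block_def)
  have ga: "?g a = 0" "?g (a + int n) = 0" by (simp_all add: bump_def)
  have nonneg: "0 \<le> AB" "0 \<le> DB" by (simp_all add: AB_def DB_def sum_nonneg)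
  have card: "real (card (block a n)) = n" by (simp add: block_def)
  have fin: "finite (block a n)" by (simp add: block_def)
  \<comment> \<open>The bump vanishes at \<open>a\<close>, so the tested range may start at
    \<open>a + 1\<close>; this excludes the source even when \<open>a = 0\<close>.\<close>
  have "of_real mass * (\<Sum>y\<in>{a+1..?b}. of_real (?g y) * V y) + of_real (s/3) * Z2
     + of_real (s/3 * sin \<theta>) * \<i> * (\<Sum>y\<in>{a+1..?b}. of_int (e y) * (of_real (?g y) * V y)) = 0"
    using tested[of "a+1" ?b "\<lambda>y. of_real (?g y)"] a n ga by (simp add: Z2_def block_def)
  then have "of_real mass * Z1 + of_real (s/3) * Z2 + of_real (s/3 * sin \<theta>) * \<i> * Z = 0"
    unfolding Z1_def Z_def bi using ga by (simp add: mult.assoc)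
  then have "of_real (s/3 * sin \<theta>) * (- \<i> * Z) = of_real mass * Z1 + of_real (s/3) * Z2"
    by (simp add: add_eq_0_iff mult_ac)
  then have "(norm (of_real (s/3 * sin \<theta>) * (- \<i> * Z)))\<^sup>2 \<le> 2 * ((norm (of_real mass * Z1))\<^sup>2 + (norm (of_real (s/3) * Z2))\<^sup>2)"
    by (simp only: norm_add2_sq)
  then have zz: "(s/3)\<^sup>2 * (sin \<theta>)\<^sup>2 * (norm Z)\<^sup>2 \<le> 2 * (mass\<^sup>2 * (norm Z1)\<^sup>2 + (s/3)\<^sup>2 * (norm Z2)\<^sup>2)"
    unfolding norm_mult power_mult_distrib norm_minus_cancel norm_ii norm_of_real power2_abs by simp
  have "(\<Sum>y\<in>block a n. (?g y)\<^sup>2) \<le> (\<Sum>y\<in>block a n. 1)"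
    using bump_bounds[OF n, of a] by (intro sum_mono) (auto simp: block_def power_le_one)
  then have g1: "(\<Sum>y\<in>block a n. (?g y)\<^sup>2) \<le> n" using card by simp
  have z1: "(norm Z1)\<^sup>2 \<le> n * AB" unfolding Z1_def AB_def
    by (rule order_trans[OF norm_sum_cs]) (use g1 in \<open>auto intro!: mult_right_mono sum_nonneg\<close>)
  have "(\<Sum>y\<in>block a n. (?g (y+1) - ?g y)\<^sup>2) \<le> (\<Sum>y\<in>block a n. (1 / real n)\<^sup>2)"
    using bump_diff[OF n, of a] by (intro sum_mono) (auto simp: block_def simp flip: abs_le_square_iff)
  also have "\<dots> = 1 / n" using card n by (simp add: power2_eq_square)
  finally have g2: "(\<Sum>y\<in>block a n. (?g (y+1) - ?g y)\<^sup>2) \<le> 1 / n" .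
  have z2: "(norm Z2)\<^sup>2 \<le> 1 / n * DB" unfolding Z2_def DB_def
    by (rule order_trans[OF norm_sum_cs mult_right_mono[OF g2]]) (auto intro: sum_nonneg)
  have sp: "0 < s" using s by simp
  have sin2: "0 < (sin \<theta>)\<^sup>2" using sin0 by simp
  have "(s/3)\<^sup>2 * (sin \<theta>)\<^sup>2 * (norm Z)\<^sup>2 \<le> 2 * (mass\<^sup>2 * (n * AB) + (s/3)\<^sup>2 * (1 / n * DB))"
    by (rule order_trans[OF zz]) (intro mult_left_mono add_mono z1 z2, auto)
  also have "\<dots> \<le> (s/3)\<^sup>2 * (sin \<theta>)\<^sup>2 * (72 * mass\<^sup>2 * n / (sin \<theta>)\<^sup>2 * AB + 2 / (n * (sin \<theta>)\<^sup>2) * DB)"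
  proof -
    \<comment> \<open>The constant \<open>72 = 2 * 4 * 9\<close> makes up for dividing by
      \<open>(s/3)^2\<close> with \<open>1 \<le> 4 * s^2\<close>.\<close>
    have "(1/2)\<^sup>2 \<le> s\<^sup>2" using s by (intro power_mono) auto
    then have "1 \<le> 4 * s\<^sup>2" by (simp add: power2_eq_square)
    from mult_right_mono[OF this, of "2 * mass\<^sup>2 * (n * AB)"]
    have "2 * mass\<^sup>2 * (n * AB) \<le> (s/3)\<^sup>2 * (72 * mass\<^sup>2 * n * AB)"
      using nonneg by (simp add: power_divide)
    moreover have "(s/3)\<^sup>2 * (sin \<theta>)\<^sup>2 * (72 * mass\<^sup>2 * n / (sin \<theta>)\<^sup>2 * AB + 2 / (n * (sin \<theta>)\<^sup>2) * DB)
       = (s/3)\<^sup>2 * (72 * mass\<^sup>2 * n * AB) + (s/3)\<^sup>2 * (2 / n * DB)"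
      using sin0 by (simp add: distrib_left mult_ac)
    ultimately show ?thesis by (simp add: distrib_left mult_ac)
  qed
  finally have zZ: "(norm Z)\<^sup>2 \<le> 72 * mass\<^sup>2 * n / (sin \<theta>)\<^sup>2 * AB + 2 / (n * (sin \<theta>)\<^sup>2) * DB"
    by (subst (asm) mult_le_cancel_left_pos) (use sp sin2 in auto)
  define Y where "Y = (\<Sum>y\<in>block a n. of_real (tailsum e a n (y+1)) * (V (y+1) - V y))"
  have Zeq: "Z = V a * of_real ?T + Y"
    using sum_abel_tail[of a ?b "\<lambda>y. of_int (e y) * of_real (?g y)" V] n
    by (simp add: Z_def Y_def block_def tailsum_def)
  have "(\<Sum>y\<in>block a n. (tailsum e a n (y+1))\<^sup>2) \<le> (\<Sum>y\<in>block a n. M\<^sup>2)"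
    using M by (intro sum_mono) (fastforce simp flip: abs_le_square_iff)
  then have y: "(norm Y)\<^sup>2 \<le> (M\<^sup>2 * n) * DB"
    unfolding Y_def DB_def using card
    by (intro order_trans[OF norm_sum_cs] mult_right_mono) (auto intro!: sum_nonneg simp: mult.commute)
  have d: "(norm ((V a - V 0) * of_real ?T))\<^sup>2 \<le> a * D * ?T\<^sup>2"
    unfolding norm_mult power_mult_distrib norm_of_real power2_abs
    using diff_le[of a] a by (intro mult_right_mono) auto
  have "(E * ?T)\<^sup>2 \<le> (norm (V 0 * of_real ?T))\<^sup>2"
    unfolding norm_mult power_mult_distrib norm_of_real power2_abs
    using E_le_norm E_nonneg by (intro mult_right_mono power_mono) auto
  also have "V 0 * of_real ?T = Z + (- Y) + (- ((V a - V 0) * of_real ?T))"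
    unfolding Zeq by (simp add: algebra_simps)
  also have "(norm \<dots>)\<^sup>2 \<le> 3 * ((norm Z)\<^sup>2 + (norm Y)\<^sup>2 + (norm ((V a - V 0) * of_real ?T))\<^sup>2)"
    using norm_add3_sq[of Z "-Y" "- ((V a - V 0) * of_real ?T)"] by (simp only: norm_minus_cancel)
  also have "\<dots> \<le> 3 * ((72 * mass\<^sup>2 * n / (sin \<theta>)\<^sup>2 * AB + 2 / (n * (sin \<theta>)\<^sup>2) * DB) + (M\<^sup>2 * n) * DB + a * D * ?T\<^sup>2)"
    by (intro mult_left_mono add_mono zZ y d) auto
  finally show ?thesis unfolding AB_def DB_def by (simp add: algebra_simps)
qed

end

lemma shifted_block_end:
  assumes "j < N"
  shows "int ((N + j) * n) + int n \<le> int (2 * N * n)"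
proof -
  have "N + j + 1 \<le> 2 * N" using assms by simp
  then have "(N + j + 1) * n \<le> 2 * N * n" by (rule mult_right_mono) auto
  then show ?thesis by (simp only: add_mult_distrib flip: of_nat_add)
qed

lemma shifted_block_div:
  assumes "y \<in> block (int ((N + j) * n)) n" "0 < n"
  shows "y div int n = int (N + j)"
proof (rule int_div_pos_eq[of _ _ _ "y - int ((N + j) * n)"])
qed (use assms in \<open>auto simp: block_def\<close>)

lemma disjoint_shifted_blocks:
  assumes "0 < n"
  shows "disjoint_family_on (\<lambda>j. block (int ((N + j) * n)) n) J"
  unfolding disjoint_family_on_def
  using shifted_block_div[OF _ assms] by (metis (no_types, lifting) IntE add_left_cancel equals0I of_nat_eq_iff)

lemma sum_blocks_le:
  fixes h :: "int \<Rightarrow> real"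
  assumes "\<And>y. 0 \<le> h y" "0 < n" "J \<subseteq> {..<N}" "finite X" "{0..int (2 * N * n)} \<subseteq> X"
  shows "(\<Sum>j\<in>J. \<Sum>y\<in>block (int ((N + j) * n)) n. h y) \<le> (\<Sum>y\<in>X. h y)"
proof -
  have "(\<Sum>j\<in>J. \<Sum>y\<in>block (int ((N + j) * n)) n. h y) = (\<Sum>y\<in>(\<Union>j\<in>J. block (int ((N + j) * n)) n). h y)"
  proof (rule sum.UNION_disjoint[symmetric])
    show "finite J" using assms(3) finite_subset by blast
    show "\<forall>i\<in>J. finite (block (int ((N + i) * n)) n)" by (simp add: block_def)
    show "\<forall>i\<in>J. \<forall>j\<in>J. i \<noteq> j \<longrightarrow> block (int ((N + i) * n)) n \<inter> block (int ((N + j) * n)) n = {}"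
      using disjoint_shifted_blocks[OF assms(2), of N J] by (simp add: disjoint_family_on_def)
  qed
  also have "\<dots> \<le> (\<Sum>y\<in>X. h y)"
  proof (rule sum_mono2[OF assms(4)])
    show "(\<Union>j\<in>J. block (int ((N + j) * n)) n) \<subseteq> X"
    proof
      fix y assume "y \<in> (\<Union>j\<in>J. block (int ((N + j) * n)) n)"
      then obtain j where j: "j \<in> J" "y \<in> block (int ((N + j) * n)) n" by auto
      have "int ((N + j) * n) + int n \<le> int (2 * N * n)" by (rule shifted_block_end) (use j assms(3) in auto)
      moreover have "0 \<le> int ((N + j) * n)" by simp
      ultimately have "y \<in> {0..int (2 * N * n)}" using j(2) unfolding block_def atLeastAtMost_iff by linarith
      then show "y \<in> X" using assms(5) by auto
    qed
  qed (use assms in auto)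
  finally show ?thesis .
qed

text \<open>Summing \<open>block_bound\<close> over disjoint blocks costs only one copy of
  \<open>A\<close> and of \<open>D\<close>, while the left side collects \<open>E^2\<close> times
  the total of the squared weighted sums. Everything on the right is linear in \<open>E\<close>, so
  one factor cancels.\<close>

lemma (in resolvent) E_upper_bound:
  fixes N n :: nat and J :: "nat set" and M W :: real
  assumes n: "0 < n" and J: "J \<subseteq> {..<N}"
    and M: "\<And>j y. j \<in> J \<Longrightarrow> y \<in> block (int ((N + j) * n)) n \<Longrightarrow> \<bar>tailsum e (int ((N + j) * n)) n (y+1)\<bar> \<le> M"
    and W: "0 < W" "W \<le> (\<Sum>j\<in>J. (tailsum e (int ((N + j) * n)) n (int ((N + j) * n)))\<^sup>2)"
    and M1: "1 \<le> M" "M\<^sup>2 \<le> N * W"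
    and \<theta>: "\<theta> \<noteq> 0" "\<bar>\<theta>\<bar> \<le> 1" "1 - s \<le> \<theta>\<^sup>2"
  shows "E \<le> 1800 * (N * n) + 144 / (n * \<theta>\<^sup>2 * W)"
proof -
  let ?a = "\<lambda>j. int ((N + j) * n)"
  let ?T = "\<lambda>j. tailsum e (?a j) n (?a j)"
  define W' where "W' = (\<Sum>j\<in>J. (?T j)\<^sup>2)"
  have W': "0 < W'" "W \<le> W'" using W by (auto simp: W'_def)
  show ?thesis
  proof (cases "2 * N * n \<le> K")
    \<comment> \<open>If the blocks do not fit into the strip, its width alone bounds the energy by
      \<open>12 * N * n\<close>.\<close>
    case False
    have "0 < N" using M1 W by (cases N) auto
    then have "0 < N * n" using n by simp
    have "K + 1 \<le> 2 * int (N * n)" using False by (simp add: mult.assoc)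
    then have "6 * real_of_int (K + 1) \<le> 6 * (2 * (real N * real n))"
      by (metis (no_types, opaque_lifting) mult_left_mono of_int_le_iff of_int_mult of_int_numeral of_int_of_nat_eq of_nat_mult zero_le_numeral)
    then have "E \<le> 12 * (N * n)" using E_le_K by simp
    also have "\<dots> \<le> 1800 * (N * n)" by simp
    also have "\<dots> \<le> 1800 * (N * n) + 144 / (n * \<theta>\<^sup>2 * W)" using W by simp
    finally show ?thesis .
  next
    case True
    have sin2: "\<theta>\<^sup>2 / 4 \<le> (sin \<theta>)\<^sup>2" by (rule sin_sq_bounds) (use \<theta> in auto)
    have th2: "0 < \<theta>\<^sup>2" using \<theta> by simp
    have sin2p: "0 < (sin \<theta>)\<^sup>2" using sin2 th2 by linarith
    then have sin0: "sin \<theta> \<noteq> 0" by auto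
    have aj: "?a j + int n \<le> K" "?a j \<le> 2 * int (N * n)" if "j \<in> J" for j
    proof -
      have "?a j + int n \<le> int (2 * N * n)" by (rule shifted_block_end) (use that J in auto)
      then show "?a j + int n \<le> K" "?a j \<le> 2 * int (N * n)" using True by (auto simp: mult.assoc)
    qed
    have "E\<^sup>2 * W' = (\<Sum>j\<in>J. (E * ?T j)\<^sup>2)" by (simp add: W'_def sum_distrib_left power_mult_distrib)
    also have "\<dots> \<le> (\<Sum>j\<in>J. 3 * (72 * mass\<^sup>2 * n / (sin \<theta>)\<^sup>2 * (\<Sum>y\<in>block (?a j) n. (norm (V y))\<^sup>2)
     + (2 / (n * (sin \<theta>)\<^sup>2) + M\<^sup>2 * n) * (\<Sum>y\<in>block (?a j) n. (norm (V (y+1) - V y))\<^sup>2)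
     + (2 * (N * n)) * D * (?T j)\<^sup>2))"
    proof (rule sum_mono)
      fix j assume j: "j \<in> J"
      have "(E * ?T j)\<^sup>2 \<le> 3 * (72 * mass\<^sup>2 * n / (sin \<theta>)\<^sup>2 * (\<Sum>y\<in>block (?a j) n. (norm (V y))\<^sup>2)
       + (2 / (n * (sin \<theta>)\<^sup>2) + M\<^sup>2 * n) * (\<Sum>y\<in>block (?a j) n. (norm (V (y+1) - V y))\<^sup>2)
       + (?a j) * D * (?T j)\<^sup>2)"
        by (rule block_bound) (use n aj[OF j] sin0 M[OF j] in auto)
      also have "\<dots> \<le> 3 * (72 * mass\<^sup>2 * n / (sin \<theta>)\<^sup>2 * (\<Sum>y\<in>block (?a j) n. (norm (V y))\<^sup>2)
       + (2 / (n * (sin \<theta>)\<^sup>2) + M\<^sup>2 * n) * (\<Sum>y\<in>block (?a j) n. (norm (V (y+1) - V y))\<^sup>2)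
       + (2 * (N * n)) * D * (?T j)\<^sup>2)"
      proof -
        have "real_of_int (?a j) \<le> real_of_int (2 * int (N * n))" using aj(2)[OF j] by (rule of_int_le_iff[THEN iffD2])
        then have "?a j * D * (?T j)\<^sup>2 \<le> (2 * (N * n)) * D * (?T j)\<^sup>2"
          using D_nonneg by (intro mult_right_mono) auto
        then show ?thesis by (intro mult_left_mono add_left_mono) auto
      qed
      finally show "(E * ?T j)\<^sup>2 \<le> \<dots>" .
    qed
    also have "\<dots> = 3 * (72 * mass\<^sup>2 * n / (sin \<theta>)\<^sup>2 * (\<Sum>j\<in>J. \<Sum>y\<in>block (?a j) n. (norm (V y))\<^sup>2)
     + (2 / (n * (sin \<theta>)\<^sup>2) + M\<^sup>2 * n) * (\<Sum>j\<in>J. \<Sum>y\<in>block (?a j) n. (norm (V (y+1) - V y))\<^sup>2)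
     + (2 * (N * n)) * D * W')"
      unfolding W'_def sum_distrib_left[symmetric] sum.distrib by simp
    also have "\<dots> \<le> 3 * (72 * mass\<^sup>2 * n / (sin \<theta>)\<^sup>2 * A + (2 / (n * (sin \<theta>)\<^sup>2) + M\<^sup>2 * n) * D + (2 * (N * n)) * D * W')"
    proof -
      have "(\<Sum>j\<in>J. \<Sum>y\<in>block (?a j) n. (norm (V y))\<^sup>2) \<le> A" unfolding A_def
        by (rule sum_blocks_le) (use n J True K in auto)
      moreover have "(\<Sum>j\<in>J. \<Sum>y\<in>block (?a j) n. (norm (V (y+1) - V y))\<^sup>2) \<le> D" unfolding D_def
        by (rule sum_blocks_le) (use n J True K in auto)
      ultimately show ?thesis using D_nonneg W' by (intro mult_left_mono add_mono) auto
    qed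
    also have "\<dots> = 3 * (72 * n * (mass / (sin \<theta>)\<^sup>2) * (mass * A) + (2 / (n * (sin \<theta>)\<^sup>2) + M\<^sup>2 * n + 2 * (N * n) * W') * D)"
      by (simp add: power2_eq_square algebra_simps)
    also have "\<dots> \<le> 3 * (72 * real n * 8 * E + (2 / (n * (\<theta>\<^sup>2/4)) + M\<^sup>2 * n + 2 * (N * n) * W') * (6 * E))"
    proof -
      have "mass / (sin \<theta>)\<^sup>2 \<le> (2 * \<theta>\<^sup>2) / (\<theta>\<^sup>2/4)"
        using mass_le \<theta> sin2 th2 by (intro frac_le) auto
      also have "\<dots> = 8" using \<theta> by simp
      finally have 1: "mass / (sin \<theta>)\<^sup>2 \<le> 8" .
      have 2: "2 / (n * (sin \<theta>)\<^sup>2) \<le> 2 / (n * (\<theta>\<^sup>2/4))"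
        using n th2 sin2 by (intro divide_left_mono mult_left_mono) (auto intro!: mult_pos_pos)
      show ?thesis
        using 1 2 mass_A_le D_le mass_pos A_nonneg D_nonneg W' E_nonneg n sin2p
        by (intro mult_left_mono add_mono mult_mono) auto
    qed
    also have "\<dots> = E * (3 * (576 * n + 48 / (n * \<theta>\<^sup>2) + 6 * (M\<^sup>2 * n) + 12 * (N * n) * W'))"
      by (simp add: algebra_simps)
    finally have main: "E * (E * W') \<le> E * (3 * (576 * n + 48 / (n * \<theta>\<^sup>2) + 6 * (M\<^sup>2 * n) + 12 * (N * n) * W'))"
      by (simp add: power2_eq_square mult.assoc)
    show ?thesis
    proof (cases "E = 0")
      case True
      then show ?thesis using W by simp
    next
      case False
      then have "0 < E" using E_nonneg by simp
      with main have "E * W' \<le> 3 * (576 * n + 48 / (n * \<theta>\<^sup>2) + 6 * (M\<^sup>2 * n) + 12 * (N * n) * W')"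
        by (subst (asm) mult_le_cancel_left_pos) auto
      \<comment> \<open>The conditions \<open>1 \<le> M\<close> and \<open>M^2 \<le> N * W\<close>
        absorb both \<open>n\<close> and \<open>M^2 * n\<close> into \<open>N * n * W'\<close>. Then
        \<open>576 + 6 + 12 \<le> 600\<close>, and the final constants are \<open>3 * 600\<close>
        and \<open>3 * 48\<close>.\<close>
      also have "\<dots> \<le> 3 * (576 * (real N * n * W') + 48 / (n * \<theta>\<^sup>2) + 6 * (real N * n * W') + 12 * (real N * n * W'))"
      proof -
        have "M\<^sup>2 \<le> N * W'" using M1(2) W' by (meson mult_left_mono of_nat_0_le_iff order_trans)
        from mult_right_mono[OF this, of "real n"] have c2: "M\<^sup>2 * n \<le> real N * n * W'" by (simp add: mult_ac)
        have c1: "real n \<le> M\<^sup>2 * n" using M1 n by (simp add: one_le_power)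
        have c3: "real n \<le> real N * (real n * W')" using order_trans[OF c1 c2] by (simp only: mult.assoc)
        show ?thesis by (intro mult_left_mono add_mono c2) (use c3 W' in \<open>auto simp: mult.assoc\<close>)
      qed
      also have "\<dots> \<le> 3 * (600 * (real N * n * W') + 48 / (n * \<theta>\<^sup>2))" using W' by simp
      also have "\<dots> = (1800 * (N * n) + 144 / (n * \<theta>\<^sup>2 * W')) * W'"
        using W' by (simp add: distrib_right)
      finally have "E * W' \<le> (1800 * (N * n) + 144 / (n * \<theta>\<^sup>2 * W')) * W'" .
      then have "E \<le> 1800 * (N * n) + 144 / (n * \<theta>\<^sup>2 * W')"
        using W'(1) mult_le_cancel_right_pos by blast
      also have "144 / (n * \<theta>\<^sup>2 * W') \<le> 144 / (n * \<theta>\<^sup>2 * W)"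
        using n th2 W W' by (intro divide_left_mono mult_left_mono) (auto intro!: mult_pos_pos)
      finally show ?thesis by simp
    qed
  qed
qed

section \<open>Integration over the frequency\<close>

text \<open>A summable return series would bound \<open>- ln t\<close>, the integral of
  \<open>1 / \<theta>\<close> over \<open>{t..1}\<close>, uniformly in \<open>t\<close>. For each
  \<open>t\<close> the strip and the killing are chosen just weak enough for the lower bound on that
  interval.\<close>

lemma recurrence_criterion:
  fixes S :: "int \<Rightarrow> real"
  assumes e: "\<And>y. e y \<in> {-1, 1}" and S: "\<And>y. S y - S (y-1) = e y" "\<And>y. \<bar>S y\<bar> \<le> C"
  shows "\<not> summable (\<lambda>n. walk_prob e n (0,0) (0,0))"
proof
  assume sm: "summable (\<lambda>n. walk_prob e n (0,0) (0,0))"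
  define G where "G = (\<Sum>n. walk_prob e n (0,0) (0,0))"
  define C' where "C' = max C 1"
  have C': "1 \<le> C'" "\<And>y. \<bar>S y\<bar> \<le> C'" using S(2) by (auto simp: C'_def le_max_iff_disj)
  have *: "- ln t \<le> 280 * pi * C'\<^sup>2 * G" if t: "0 < t" "t \<le> 1" for t :: real
  proof -
    define s where "s = 1 - t\<^sup>2 / 2"
    define K where "K = \<lceil>2 / t\<rceil>"
    have "t\<^sup>2 \<le> 1" using t by (simp add: power_le_one)
    then have s: "1/2 \<le> s" "s < 1" using t by (auto simp: s_def)
    have "0 \<le> 2 / t" using t by simp
    then have K: "0 \<le> K" unfolding K_def by linarith
    interpret R: resolvent K e s \<theta> "resolv K e s \<theta>" for \<theta>
      by (rule resolvent_resolv) (use K s e in auto)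
    let ?f = "\<lambda>\<theta>. Re (resolv K e s \<theta> 0)"
    have f0: "0 \<le> ?f \<theta>" for \<theta> using R.E_nonneg unfolding R.E_def .
    have int: "(?f has_integral (2 * pi * (\<Sum>n. s ^ n * killed K e n 0 0))) {-pi..pi}"
      using killed_gf s by simp
    have "{t..1} \<subseteq> {-pi..pi}" using t pi_gt3 by auto
    then have int': "?f integrable_on {t..1}"
      using int integrable_on_subinterval by blast
    have low: "1 / (140 * C'\<^sup>2) * (1 / \<theta>) \<le> ?f \<theta>" if "\<theta> \<in> {t..1}" for \<theta>
    proof -
      have \<theta>: "0 < \<theta>" "t \<le> \<theta>" "\<theta> \<le> 1" using that t by auto
      have "t\<^sup>2 \<le> \<theta>\<^sup>2" using \<theta> t by (intro power_mono) auto
      then have s\<theta>: "1 - s \<le> \<theta>\<^sup>2" using zero_le_power2[of \<theta>] unfolding s_def by linarith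
      have 1: "1 \<le> 1 / \<theta>" using \<theta> by simp
      have "real_of_int \<lceil>1 / \<theta>\<rceil> \<le> 1 / \<theta> + 1" by (rule of_int_ceiling_le_add_one)
      also have "\<dots> \<le> 1 / \<theta> + 1 / \<theta>" using 1 by simp
      finally have L2: "real_of_int \<lceil>1 / \<theta>\<rceil> \<le> 2 / \<theta>" by simp
      have "2 / \<theta> \<le> 2 / t" using \<theta> t by (intro divide_left_mono) auto
      with L2 have LK: "\<lceil>1 / \<theta>\<rceil> \<le> K" unfolding K_def by (metis ceiling_mono ceiling_of_int order_trans)
      have "1 \<le> 140 * C'\<^sup>2 * \<theta> * R.E \<theta>"
        by (rule R.E_lower_bound[where S=S and L="\<lceil>1 / \<theta>\<rceil>"]) (use S(1) C' \<theta> s\<theta> L2 LK 1 in \<open>auto intro: le_of_int_ceiling\<close>)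
      then have "1 \<le> (140 * C'\<^sup>2 * \<theta>) * ?f \<theta>" unfolding R.E_def .
      then show ?thesis using \<theta> C' by (simp add: field_simps)
    qed
    have "((\<lambda>\<theta>. 1 / \<theta>) has_integral (ln 1 - ln t)) {t..1}"
      by (rule fundamental_theorem_of_calculus)
         (use t in \<open>auto intro!: derivative_eq_intros simp flip: has_real_derivative_iff_has_vector_derivative\<close>)
    from has_integral_mult_right[OF this, of "1 / (140 * C'\<^sup>2)"]
    have "1 / (140 * C'\<^sup>2) * (ln 1 - ln t) \<le> integral {t..1} ?f"
      by (rule has_integral_le[OF _ integrable_integral[OF int']]) (use low in auto)
    also have "\<dots> \<le> integral {-pi..pi} ?f"
      using int int' f0 \<open>{t..1} \<subseteq> {-pi..pi}\<close> by (intro integral_subset_le) auto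
    also have "\<dots> = 2 * pi * (\<Sum>n. s ^ n * killed K e n 0 0)" using int by (rule integral_unique)
    also have "\<dots> \<le> 2 * pi * G"
    proof -
      have "(\<Sum>n. s ^ n * killed K e n 0 0) \<le> G" unfolding G_def
      proof (rule suminf_le)
        fix n
        have "s ^ n * killed K e n 0 0 \<le> 1 * walk_prob e n (0,0) (0,0)"
          using s by (intro mult_mono killed_le_walk_prob killed_nonneg) (auto simp: power_le_one)
        then show "s ^ n * killed K e n 0 0 \<le> walk_prob e n (0,0) (0,0)" by simp
      qed (use killed_gf s sm in auto)
      then show ?thesis by simp
    qed
    finally show ?thesis using C' by (simp add: field_simps)
  qed
  \<comment> \<open>At \<open>t = exp (- (B + 1))\<close> the bound \<open>- ln t \<le> B\<close>
    fails by one.\<close>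
  define B where "B = 280 * pi * C'\<^sup>2 * G"
  have "0 \<le> B" using C' suminf_nonneg[OF sm walk_prob_nonneg] by (simp add: B_def G_def)
  then have "exp (- (B + 1)) \<le> 1" by simp
  from *[OF exp_gt_zero this] have "- ln (exp (- (B + 1))) \<le> B" unfolding B_def[symmetric] .
  then show False by simp
qed

text \<open>Partial sums up to time \<open>m\<close> are compared with the walk killed outside the
  strip of half-width \<open>m\<close>, at a weight with \<open>s ^ m \<ge> 1/2\<close>. It then
  suffices to bound the integral of the resolvent uniformly in \<open>m\<close>.\<close>

lemma transience_criterion:
  assumes e: "\<And>y. e y \<in> {-1, 1}" and C: "0 \<le> C" and \<delta>: "0 < \<delta>" and t: "0 < t" "t \<le> 1"
    and bound: "\<And>K s \<theta>. \<lbrakk>0 \<le> K; 1/2 \<le> s; s < 1; \<theta> \<noteq> 0; \<bar>\<theta>\<bar> \<le> t; 1 - s \<le> \<theta>\<^sup>2\<rbrakk>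
       \<Longrightarrow> Re (resolv K e s \<theta> 0) \<le> C * \<bar>\<theta>\<bar> powr (\<delta> - 1)"
  shows "summable (\<lambda>n. walk_prob e n (0,0) (0,0))"
proof (rule summableI_nonneg_bounded)
  fix n show "0 \<le> walk_prob e n (0,0) (0,0)" by (rule walk_prob_nonneg)
next
  define B where "B = C * (pi powr \<delta> / \<delta>) + 6 / (1 - cos t) * pi + 6"
  fix m :: nat
  define \<eta> where "\<eta> = 1 / (real m + 2)"
  define s where "s = 1 - \<eta>\<^sup>2"
  have \<eta>: "0 < \<eta>" "\<eta> \<le> 1/2" by (auto simp: \<eta>_def)
  have "\<eta>\<^sup>2 \<le> (1/2)\<^sup>2" using \<eta> by (intro power_mono) auto
  then have s: "1/2 \<le> s" "s < 1" using \<eta> by (auto simp: s_def power2_eq_square)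
  have t_pi: "t \<le> pi" using t pi_gt3 by simp
  have cos_t: "cos t < 1" using cos_monotone_0_pi[of 0 t] t t_pi by simp
  interpret R: resolvent "int m" e s \<theta> "resolv (int m) e s \<theta>" for \<theta>
    by (rule resolvent_resolv) (use s e in auto)
  let ?f = "\<lambda>\<theta>. Re (resolv (int m) e s \<theta> 0)"
  \<comment> \<open>Three frequency ranges: up to \<open>\<eta>\<close> the strip bound, whose
    integral is at most 6; between \<open>\<eta>\<close> and \<open>t\<close> the hypothesis,
    available since \<open>1 - s = \<eta>^2\<close>; above \<open>t\<close> the mass bound.\<close>
  let ?h = "\<lambda>\<theta>. C * \<theta> powr (\<delta> - 1) + 6 / (1 - cos t) + (if \<theta> \<in> {0..\<eta>} then 6 * (real m + 1) else 0)"
  have fh: "?f \<theta> \<le> ?h \<bar>\<theta>\<bar>" if th: "\<bar>\<theta>\<bar> \<le> pi" for \<theta>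
  proof -
    have p: "0 \<le> C * \<bar>\<theta>\<bar> powr (\<delta> - 1)" "0 \<le> 6 / (1 - cos t)" using C cos_t by auto
    consider "\<bar>\<theta>\<bar> \<le> \<eta>" | "\<eta> < \<bar>\<theta>\<bar>" "\<bar>\<theta>\<bar> \<le> t" | "t < \<bar>\<theta>\<bar>" "\<eta> < \<bar>\<theta>\<bar>" by linarith
    then show ?thesis
    proof cases
      case 1
      then show ?thesis using R.E_le_K[of \<theta>] add_nonneg_nonneg[OF p] unfolding R.E_def by simp
    next
      case 2
      have "\<eta>\<^sup>2 \<le> \<theta>\<^sup>2" using 2 \<eta> by (simp flip: abs_le_square_iff)
      then have "?f \<theta> \<le> C * \<bar>\<theta>\<bar> powr (\<delta> - 1)"
        using 2 \<eta> s by (intro bound) (auto simp: s_def)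
      moreover have "?h \<bar>\<theta>\<bar> = C * \<bar>\<theta>\<bar> powr (\<delta> - 1) + 6 / (1 - cos t)" using 2 by simp
      ultimately show ?thesis using p by linarith
    next
      case 3
      have "cos \<theta> \<le> cos t" using cos_monotone_0_pi_le[of t "\<bar>\<theta>\<bar>"] 3 t th by simp
      then have "(1 - cos t) \<le> 6 * R.mass \<theta>" using R.mass_ge[of \<theta>] by linarith
      then have "(1 - cos t) * R.E \<theta> \<le> 6 * R.mass \<theta> * R.E \<theta>" by (intro mult_right_mono R.E_nonneg)
      also have "\<dots> \<le> 6" using R.E_le_mass[of \<theta>] by simp
      finally have "R.E \<theta> \<le> 6 / (1 - cos t)" using cos_t by (simp add: field_simps)
      then show ?thesis using p 3 unfolding R.E_def by simp
    qed
  qed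
  have fh1: "?f \<theta> \<le> ?h \<theta>" and fh2: "?f (- \<theta>) \<le> ?h \<theta>" if "\<theta> \<in> {0..pi}" for \<theta>
  proof -
    have "\<bar>\<theta>\<bar> = \<theta>" "\<bar>- \<theta>\<bar> = \<theta>" "\<theta> \<le> pi" using that by auto
    then show "?f \<theta> \<le> ?h \<theta>" "?f (- \<theta>) \<le> ?h \<theta>" using fh[of \<theta>] fh[of "- \<theta>"] by (simp_all only:)
  qed
  have hint: "(?h has_integral (C * (pi powr \<delta> / \<delta>) + 6 / (1 - cos t) * pi + 6 * (real m + 1) * \<eta>)) {0..pi}"
  proof (intro has_integral_add has_integral_mult_right)
    show "((\<lambda>\<theta>. \<theta> powr (\<delta> - 1)) has_integral pi powr \<delta> / \<delta>) {0..pi}"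
      using has_integral_powr_from_0[of "\<delta> - 1" pi] \<delta> by simp
    show "((\<lambda>\<theta>. 6 / (1 - cos t)) has_integral 6 / (1 - cos t) * pi) {0..pi}"
      using has_integral_const_real[of "6 / (1 - cos t)" 0 pi] by (simp add: mult.commute)
    have "{0..\<eta>} \<subseteq> {0..pi}" using \<eta> pi_gt3 by auto
    then show "((\<lambda>\<theta>. if \<theta> \<in> {0..\<eta>} then 6 * (real m + 1) else 0) has_integral 6 * (real m + 1) * \<eta>) {0..pi}"
      using has_integral_const_real[of "6 * (real m + 1)" 0 \<eta>] \<eta>
      by (subst has_integral_restrict) (auto simp: mult.commute)
  qed
  have hB: "C * (pi powr \<delta> / \<delta>) + 6 / (1 - cos t) * pi + 6 * (real m + 1) * \<eta> \<le> B"
    unfolding B_def \<eta>_def by (simp add: field_simps)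
  have int: "(?f has_integral (2 * pi * (\<Sum>n. s ^ n * killed (int m) e n 0 0))) {-pi..pi}"
    using killed_gf s by simp
  then have fi: "?f integrable_on {-pi..pi}" by blast
  have fi1: "?f integrable_on {0..pi}" "?f integrable_on {-pi..0}"
    using integrable_on_subinterval[OF fi] by auto
  have refl1: "(\<lambda>x. F (-x)) integrable_on {0..pi} \<longleftrightarrow> F integrable_on {-pi..0}" for F :: "real \<Rightarrow> real"
    using Henstock_Kurzweil_Integration.integrable_reflect_real[where f=F and a="-pi" and b=0] by (simp only: minus_zero minus_minus)
  have refl2: "integral {0..pi} (\<lambda>x. F (-x)) = integral {-pi..0} F" for F :: "real \<Rightarrow> real"
    using Henstock_Kurzweil_Integration.integral_reflect_real[where f=F and a="-pi" and b=0] by (simp only: minus_zero minus_minus)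
  have fi2: "(\<lambda>\<theta>. ?f (-\<theta>)) integrable_on {0..pi}"
    using refl1[of ?f] fi1(2) by blast
  have "integral {-pi..pi} ?f = integral {-pi..0} ?f + integral {0..pi} ?f"
    using fi by (intro Henstock_Kurzweil_Integration.integral_combine[symmetric]) auto
  also have "integral {-pi..0} ?f = integral {0..pi} (\<lambda>\<theta>. ?f (-\<theta>))"
    by (rule refl2[of ?f, symmetric])
  also have "\<dots> \<le> B"
    by (rule order_trans[OF has_integral_le[OF integrable_integral[OF fi2] hint] hB])
       (rule fh2)
  also have "integral {0..pi} ?f \<le> B"
    by (rule order_trans[OF has_integral_le[OF integrable_integral[OF fi1(1)] hint] hB])
       (rule fh1)
  finally have "2 * pi * (\<Sum>n. s ^ n * killed (int m) e n 0 0) \<le> 2 * B"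
    unfolding integral_unique[OF int] by simp
  moreover have "0 \<le> (\<Sum>n. s ^ n * killed (int m) e n 0 0)"
    using killed_gf s by (intro suminf_nonneg) (auto simp: killed_nonneg)
  moreover have "1 \<le> pi" using pi_gt3 by simp
  ultimately have gB: "(\<Sum>n. s ^ n * killed (int m) e n 0 0) \<le> B"
    using mult_right_mono[of 1 pi "\<Sum>n. s ^ n * killed (int m) e n 0 0"] by linarith
  have "2 * real m \<le> (real m + 2)\<^sup>2" by (simp add: power2_sum)
  then have "real m * \<eta>\<^sup>2 \<le> 1/2" unfolding \<eta>_def by (simp add: power_divide divide_le_eq)
  then have "1/2 \<le> 1 + real m * (- \<eta>\<^sup>2)" by simp
  also have "\<dots> \<le> s ^ m" unfolding s_def
    using Bernoulli_inequality[of "- \<eta>\<^sup>2" m] s by (simp add: s_def)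
  finally have sm: "1/2 \<le> s ^ m" .
  have "(\<Sum>n<m. walk_prob e n (0,0) (0,0)) \<le> (\<Sum>n<m. 2 * (s ^ n * killed (int m) e n 0 0))"
  proof (rule sum_mono)
    fix n assume "n \<in> {..<m}"
    then have n: "n < m" by simp
    have "s ^ m \<le> s ^ n" using n s by (intro power_decreasing) auto
    then have "1 \<le> 2 * s ^ n" using sm by simp
    then have "1 * killed (int m) e n 0 0 \<le> 2 * s ^ n * killed (int m) e n 0 0"
      by (intro mult_right_mono killed_nonneg)
    then show "walk_prob e n (0,0) (0,0) \<le> 2 * (s ^ n * killed (int m) e n 0 0)"
      using killed_eq_walk_prob[of n 0 "int m" e 0] n by simp
  qed
  also have "\<dots> \<le> 2 * (\<Sum>n. s ^ n * killed (int m) e n 0 0)"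
    unfolding sum_distrib_left[symmetric] using killed_gf s
    by (intro mult_left_mono sum_le_suminf) (auto simp: killed_nonneg)
  also have "\<dots> \<le> 2 * B" using gB by simp
  finally show "(\<Sum>n<m. walk_prob e n (0,0) (0,0)) \<le> 2 * B" .
qed

text \<open>The \<open>j\<close>-th of the \<open>N\<close> blocks of length \<open>n\<close> starts at \<open>(N + j) * n\<close>, so that all blocks lie at distance
  of order \<open>N * n\<close> from the origin, where the density of random sites is comparable everywhere.\<close>

definition good_blocks :: "(int \<Rightarrow> int) \<Rightarrow> nat \<Rightarrow> nat \<Rightarrow> real \<Rightarrow> bool" where
  "good_blocks e n N W \<longleftrightarrow> (\<exists>J M. J \<subseteq> {..<N} \<and> 1 \<le> M \<and> M\<^sup>2 \<le> real N * W \<and>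
    (\<forall>j\<in>J. \<forall>y\<in>block (int ((N + j) * n)) n. \<bar>tailsum e (int ((N + j) * n)) n (y+1)\<bar> \<le> M) \<and>
    W \<le> (\<Sum>j\<in>J. (tailsum e (int ((N + j) * n)) n (int ((N + j) * n)))\<^sup>2))"

lemma (in resolvent) E_le_good_blocks:
  assumes "good_blocks e n N W" "0 < n" "0 < W" "\<theta> \<noteq> 0" "\<bar>\<theta>\<bar> \<le> 1" "1 - s \<le> \<theta>\<^sup>2"
  shows "E \<le> 1800 * (real N * real n) + 144 / (n * \<theta>\<^sup>2 * W)"
proof -
  from assms(1)[unfolded good_blocks_def] obtain J M where JM: "J \<subseteq> {..<N} \<and> 1 \<le> M \<and> M\<^sup>2 \<le> real N * W \<and>
    (\<forall>j\<in>J. \<forall>y\<in>block (int ((N + j) * n)) n. \<bar>tailsum e (int ((N + j) * n)) n (y+1)\<bar> \<le> M) \<and>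
    W \<le> (\<Sum>j\<in>J. (tailsum e (int ((N + j) * n)) n (int ((N + j) * n)))\<^sup>2)"
    by (elim exE)
  have M: "\<bar>tailsum e (int ((N + j) * n)) n (y+1)\<bar> \<le> M" if "j \<in> J" "y \<in> block (int ((N + j) * n)) n" for j y
    using JM that by blast
  from JM have "J \<subseteq> {..<N}" "1 \<le> M" "M\<^sup>2 \<le> real N * W"
    "W \<le> (\<Sum>j\<in>J. (tailsum e (int ((N + j) * n)) n (int ((N + j) * n)))\<^sup>2)" by simp_all
  from E_upper_bound[OF assms(2) this(1) M assms(3) this(4) this(2,3) assms(4-6)] show ?thesis by simp
qed

lemma transience_from_blocks:
  fixes a b z0 :: nat and \<kappa> w :: real
  assumes e: "\<And>y. e y \<in> {-1, 1}" and ab: "0 < a + b" and \<kappa>: "0 < \<kappa>" and w: "0 < w"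
    and blocks: "\<And>z. z \<ge> z0 \<Longrightarrow> good_blocks e (z^a) (z^b) (w * real z ^ b * z powr \<kappa>)"
  shows "summable (\<lambda>n. walk_prob e n (0,0) (0,0))"
proof -
  define d where "d = real (a + b)"
  \<comment> \<open>The energy bound is of order
    \<open>z powr d + 1 / (\<theta>^2 * z powr (d + \<kappa>))\<close>. Its two terms balance at
    \<open>z = \<bar>\<theta>\<bar> powr (- \<tau>)\<close>, and both then equal
    \<open>\<bar>\<theta>\<bar> powr (\<delta> - 1)\<close>.\<close>
  define \<tau> where "\<tau> = 1 / (d + \<kappa> / 2)"
  define \<delta> where "\<delta> = (\<kappa> / 2) / (d + \<kappa> / 2)"
  have d: "0 < d" using ab unfolding d_def by linarith
  have \<tau>: "0 < \<tau>" using d \<kappa> by (simp add: \<tau>_def)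
  have \<delta>: "0 < \<delta>" using d \<kappa> by (simp add: \<delta>_def)
  have e1: "\<tau> * d = 1 - \<delta>" "\<tau> * (d + \<kappa>) = 1 + \<delta>"
    using d \<kappa> by (auto simp: \<tau>_def \<delta>_def field_simps)
  \<comment> \<open>Frequencies below \<open>t\<close> have an optimal scale of at least
    \<open>z0 + 1\<close>, so that rounding down stays at or above \<open>z0\<close>.\<close>
  define t where "t = min 1 (real (z0 + 1) powr (- 1 / \<tau>))"
  have t: "0 < t" "t \<le> 1" by (auto simp: t_def)
  define C where "C = 1800 + 144 * 2 powr (d + \<kappa>) / w"
  show ?thesis
  proof (rule transience_criterion[OF e])
    fix K :: int and s \<theta> :: real
    assume K: "0 \<le> K" and s: "1/2 \<le> s" "s < 1" "1 - s \<le> \<theta>\<^sup>2" and \<theta>: "\<theta> \<noteq> 0" "\<bar>\<theta>\<bar> \<le> t"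
    define x where "x = \<bar>\<theta>\<bar> powr (- \<tau>)"
    define z where "z = nat \<lfloor>x\<rfloor>"
    have "real (z0 + 1) = (real (z0 + 1) powr (- 1 / \<tau>)) powr (- \<tau>)"
      using \<tau> by (simp add: powr_powr)
    also have "\<dots> \<le> t powr (- \<tau>)" using t \<tau> by (intro powr_mono2') (auto simp: t_def)
    also have "\<dots> \<le> x" unfolding x_def using \<theta> \<tau> by (intro powr_mono2') auto
    finally have xz0: "real (z0 + 1) \<le> x" .
    then have x1: "1 \<le> x" by simp
    have "int (z0 + 1) \<le> \<lfloor>x\<rfloor>" using xz0 by (simp add: le_floor_iff)
    then have z: "z0 \<le> z" "1 \<le> z" by (auto simp: z_def)
    have zx: "real z \<le> x" using x1 by (simp add: z_def)
    \<comment> \<open>Rounding to an integer scale loses at most a factor 2, the source of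
      \<open>2 powr (d + \<kappa>)\<close> in \<open>C\<close>.\<close>
    have "x \<le> real z + 1" using x1 by (simp add: z_def)
    then have xz: "x / 2 \<le> real z" using z by simp
    interpret R: resolvent K e s \<theta> "resolv K e s \<theta>"
      by (rule resolvent_resolv) (use K s e in auto)
    have zp: "0 < z ^ a" "0 < w * real z ^ b * real z powr \<kappa>" using z w by auto
    have "R.E \<le> 1800 * (real (z^b) * real (z^a)) + 144 / (real (z^a) * \<theta>\<^sup>2 * (w * real z ^ b * real z powr \<kappa>))"
      by (rule R.E_le_good_blocks[OF blocks[OF z(1)] zp \<theta>(1)]) (use \<theta>(2) t(2) s(3) in linarith)+
    also have "\<dots> = 1800 * (real z powr d) + 144 / w / (\<theta>\<^sup>2 * real z powr (d + \<kappa>))"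
    proof -
      have "real z ^ b * real z ^ a = real z powr d"
        unfolding d_def using z by (subst powr_realpow) (auto simp: power_add mult.commute)
      moreover have "real z powr (d + \<kappa>) = real z ^ b * real z ^ a * real z powr \<kappa>"
        using calculation by (simp add: powr_add)
      ultimately show ?thesis by (simp add: mult_ac)
    qed
    also have "real z powr d \<le> \<bar>\<theta>\<bar> powr (\<delta> - 1)"
    proof -
      have "real z powr d \<le> x powr d" using zx d by (intro powr_mono2) auto
      also have "\<dots> = \<bar>\<theta>\<bar> powr (- (\<tau> * d))" by (simp add: x_def powr_powr)
      finally show ?thesis unfolding e1 by simp
    qed
    also have "144 / w / (\<theta>\<^sup>2 * real z powr (d + \<kappa>)) \<le> 144 / w * 2 powr (d + \<kappa>) * \<bar>\<theta>\<bar> powr (\<delta> - 1)"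
    proof -
      have "(x / 2) powr (d + \<kappa>) \<le> real z powr (d + \<kappa>)" using xz x1 d \<kappa> by (intro powr_mono2) auto
      moreover have "(x / 2) powr (d + \<kappa>) = \<bar>\<theta>\<bar> powr (- (1 + \<delta>)) / 2 powr (d + \<kappa>)"
        unfolding e1(2)[symmetric] by (subst powr_divide) (auto simp: x_def powr_powr)
      moreover have "\<theta>\<^sup>2 * \<bar>\<theta>\<bar> powr (- (1 + \<delta>)) = \<bar>\<theta>\<bar> powr (1 - \<delta>)"
      proof -
        have "\<theta>\<^sup>2 = \<bar>\<theta>\<bar> powr 2" using \<theta> by simp
        then show ?thesis by (simp only: powr_add[symmetric]) simp
      qed
      ultimately have "\<bar>\<theta>\<bar> powr (1 - \<delta>) / 2 powr (d + \<kappa>) \<le> \<theta>\<^sup>2 * real z powr (d + \<kappa>)"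
        by (metis mult_left_mono times_divide_eq_right zero_le_power2)
      then have "144 / w / (\<theta>\<^sup>2 * real z powr (d + \<kappa>)) \<le> 144 / w / (\<bar>\<theta>\<bar> powr (1 - \<delta>) / 2 powr (d + \<kappa>))"
        using w \<theta> z by (intro divide_left_mono) auto
      also have "\<dots> = 144 / w * 2 powr (d + \<kappa>) * \<bar>\<theta>\<bar> powr (\<delta> - 1)"
        using powr_minus[of "\<bar>\<theta>\<bar>" "1 - \<delta>"] by (simp add: divide_simps)
      finally show ?thesis .
    qed
    finally show "Re (resolv K e s \<theta> 0) \<le> C * \<bar>\<theta>\<bar> powr (\<delta> - 1)"
      unfolding R.E_def C_def by (simp add: algebra_simps)
  qed (use t \<delta> w in \<open>auto simp: C_def\<close>)
qed

section \<open>The random environment\<close>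

abbreviation site :: "(int \<Rightarrow> real) \<Rightarrow> int \<Rightarrow> (bool \<times> bool) measure" where
  "site p y \<equiv> measure_pmf (pair_pmf (bernoulli_pmf (p y)) (bernoulli_pmf (1/2)))"

lemma prob_space_env: "prob_space (env_measure p)"
  unfolding env_measure_def by (intro prob_space_PiM prob_space_measure_pmf)

lemma space_env [simp]: "space (env_measure p) = UNIV"
  by (simp add: env_measure_def space_PiM)

lemma measurable_site:
  "y \<in> I \<Longrightarrow> (\<lambda>\<omega>. h (\<omega> y) :: real) \<in> borel_measurable (PiM I (site p))"
  by (rule measurable_compose[OF measurable_component_singleton]) auto

definition lam_real :: "(int \<Rightarrow> bool \<times> bool) \<Rightarrow> int \<Rightarrow> real" where "lam_real \<omega> y = of_bool (fst (\<omega> y))"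
definition rho_real :: "(int \<Rightarrow> bool \<times> bool) \<Rightarrow> int \<Rightarrow> real" where "rho_real \<omega> y = (if snd (\<omega> y) then 1 else -1)"

lemma eps_of_real: "real_of_int (eps_of f \<omega> y) = (1 - lam_real \<omega> y) * of_int (f y) + lam_real \<omega> y * rho_real \<omega> y"
  by (simp add: eps_of_def lam_of_def rho_of_def lam_real_def rho_real_def)

lemma lam_real_measurable: "y \<in> I \<Longrightarrow> (\<lambda>\<omega>. lam_real \<omega> y) \<in> borel_measurable (PiM I (site p))"
  unfolding lam_real_def by (rule measurable_site[where h="\<lambda>v. of_bool (fst v)"])

lemma rho_real_measurable: "y \<in> I \<Longrightarrow> (\<lambda>\<omega>. rho_real \<omega> y) \<in> borel_measurable (PiM I (site p))"
  unfolding rho_real_def by (rule measurable_site[where h="\<lambda>v. if snd v then 1 else -1"])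

lemma indep_coords: "prob_space.indep_vars (env_measure p) (site p) (\<lambda>i \<omega>. \<omega> i) UNIV"
proof -
  interpret prob_space "env_measure p" by (rule prob_space_env)
  interpret P: product_prob_space "site p" UNIV
    by (intro product_prob_spaceI prob_space_measure_pmf)
  have "distr (env_measure p) (PiM UNIV (site p)) (\<lambda>x. \<lambda>i\<in>UNIV. x i) = PiM UNIV (site p)"
    using distr_id[of "PiM UNIV (site p)"] by (simp add: env_measure_def restrict_def)
  also have "\<dots> = PiM UNIV (\<lambda>i. distr (env_measure p) (site p i) (\<lambda>\<omega>. \<omega> i))"
    by (simp add: env_measure_def P.PiM_component)
  finally show ?thesis
    by (subst indep_vars_iff_distr_eq_PiM) (auto simp: env_measure_def)
qed

section \<open>Symmetry of the environment under reversing one sign\<close>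

definition flip :: "int \<Rightarrow> (int \<Rightarrow> bool \<times> bool) \<Rightarrow> int \<Rightarrow> bool \<times> bool" where
  "flip y \<omega> = (\<lambda>i. if i = y then (fst (\<omega> y), \<not> snd (\<omega> y)) else \<omega> i)"

lemma lam_real_flip [simp]: "lam_real (flip y \<omega>) x = lam_real \<omega> x"
  and rho_real_flip: "rho_real (flip y \<omega>) x = (if x = y then - rho_real \<omega> x else rho_real \<omega> x)"
  by (auto simp: lam_real_def rho_real_def flip_def)

lemma map_Not_bernoulli_half: "map_pmf Not (bernoulli_pmf (1/2)) = bernoulli_pmf (1/2)"
proof (rule pmf_eqI)
  fix b
  have "pmf (map_pmf Not (bernoulli_pmf (1/2))) (Not (\<not> b)) = pmf (bernoulli_pmf (1/2)) (\<not> b)"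
    by (rule pmf_map_inj') (auto simp: inj_def)
  then show "pmf (map_pmf Not (bernoulli_pmf (1/2))) b = pmf (bernoulli_pmf (1/2)) b"
    by (cases b) auto
qed

lemma flip_measurable: "flip y \<in> measurable (env_measure p) (env_measure p)"
  unfolding env_measure_def
proof (rule measurable_PiM_single')
  fix i
  show "(\<lambda>\<omega>. flip y \<omega> i) \<in> measurable (PiM UNIV (site p)) (site p i)"
    unfolding flip_def by (cases "i = y") (auto intro!: measurable_compose[OF measurable_component_singleton])
qed (auto simp: space_PiM)

text \<open>The map acts coordinatewise and alters only a fair sign, so every marginal and the
  independence are preserved.\<close>

lemma flip_measure_preserving: "distr (env_measure p) (env_measure p) (flip y) = env_measure p"
proof -
  interpret prob_space "env_measure p" by (rule prob_space_env)
  interpret P: product_prob_space "site p" UNIV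
    by (intro product_prob_spaceI prob_space_measure_pmf)
  define F where "F i = (if i = y then map_prod id Not else (id :: bool \<times> bool \<Rightarrow> bool \<times> bool))" for i :: int
  have fl: "flip y \<omega> = (\<lambda>i\<in>UNIV. F i (\<omega> i))" for \<omega>
    by (auto simp: flip_def F_def fun_eq_iff map_prod_def split: prod.splits)
  have ind: "indep_vars (site p) (\<lambda>i \<omega>. F i (\<omega> i)) UNIV"
    by (rule indep_vars_compose2[OF indep_coords]) auto
  have "distr (env_measure p) (PiM UNIV (site p)) (\<lambda>\<omega>. \<lambda>i\<in>UNIV. F i (\<omega> i))
     = PiM UNIV (\<lambda>i. distr (env_measure p) (site p i) (\<lambda>\<omega>. F i (\<omega> i)))"
    using ind by (subst (asm) indep_vars_iff_distr_eq_PiM) (use ind in \<open>auto simp: indep_vars_def\<close>)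
  also have "(\<lambda>i. distr (env_measure p) (site p i) (\<lambda>\<omega>. F i (\<omega> i))) = site p"
  proof
    fix i
    have "distr (env_measure p) (site p i) (\<lambda>\<omega>. F i (\<omega> i)) = distr (distr (env_measure p) (site p i) (\<lambda>\<omega>. \<omega> i)) (site p i) (F i)"
      by (subst distr_distr) (auto simp: env_measure_def o_def)
    also have "distr (env_measure p) (site p i) (\<lambda>\<omega>. \<omega> i) = site p i"
      by (simp add: env_measure_def P.PiM_component)
    also have "distr (site p i) (site p i) (F i) = distr (site p i) (count_space UNIV) (F i)"
      by (rule distr_cong) auto
    also have "\<dots> = measure_pmf (map_pmf (F i) (pair_pmf (bernoulli_pmf (p i)) (bernoulli_pmf (1/2))))"
      by (simp add: map_pmf_rep_eq)
    also have "map_pmf (F i) (pair_pmf (bernoulli_pmf (p i)) (bernoulli_pmf (1/2))) = pair_pmf (bernoulli_pmf (p i)) (bernoulli_pmf (1/2))"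
      using map_pair[of id Not "bernoulli_pmf (p i)" "bernoulli_pmf (1/2)"] map_Not_bernoulli_half
      by (auto simp: F_def map_prod_def pmf.map_id)
    finally show "distr (env_measure p) (site p i) (\<lambda>\<omega>. F i (\<omega> i)) = site p i" .
  qed
  finally show ?thesis by (simp add: fl[abs_def] env_measure_def restrict_def)
qed

text \<open>A class closed under sums and products, which makes every polynomial in the site
  variables integrable by an introduction rule set.\<close>

definition bounded_rv :: "(int \<Rightarrow> real) \<Rightarrow> ((int \<Rightarrow> bool \<times> bool) \<Rightarrow> real) \<Rightarrow> bool" where
  "bounded_rv p F \<longleftrightarrow> F \<in> borel_measurable (env_measure p) \<and> (\<exists>c. \<forall>\<omega>. \<bar>F \<omega>\<bar> \<le> c)"

lemma bounded_rv_const: "bounded_rv p (\<lambda>_. c)" by (auto simp: bounded_rv_def)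

lemma bounded_rv_add: "bounded_rv p F \<Longrightarrow> bounded_rv p G \<Longrightarrow> bounded_rv p (\<lambda>\<omega>. F \<omega> + G \<omega>)"
proof -
  assume "bounded_rv p F" "bounded_rv p G"
  then obtain c d where "F \<in> borel_measurable (env_measure p)" "G \<in> borel_measurable (env_measure p)"
     "\<And>\<omega>. \<bar>F \<omega>\<bar> \<le> c" "\<And>\<omega>. \<bar>G \<omega>\<bar> \<le> d" by (auto simp: bounded_rv_def)
  then show ?thesis unfolding bounded_rv_def
    by (intro conjI exI[of _ "c + d"]) (auto intro: order_trans[OF abs_triangle_ineq] add_mono)
qed

lemma bounded_rv_mult: "bounded_rv p F \<Longrightarrow> bounded_rv p G \<Longrightarrow> bounded_rv p (\<lambda>\<omega>. F \<omega> * G \<omega>)"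
proof -
  assume "bounded_rv p F" "bounded_rv p G"
  then obtain c d where *: "F \<in> borel_measurable (env_measure p)" "G \<in> borel_measurable (env_measure p)"
     "\<And>\<omega>. \<bar>F \<omega>\<bar> \<le> c" "\<And>\<omega>. \<bar>G \<omega>\<bar> \<le> d" by (auto simp: bounded_rv_def)
  have "0 \<le> c" using *(3)[of undefined] by linarith
  with * show ?thesis unfolding bounded_rv_def
    by (intro conjI exI[of _ "c * d"]) (auto simp: abs_mult intro!: mult_mono)
qed

lemma bounded_rv_sum: "(\<And>i. i \<in> I \<Longrightarrow> bounded_rv p (F i)) \<Longrightarrow> bounded_rv p (\<lambda>\<omega>. \<Sum>i\<in>I. F i \<omega>)"
  by (induction I rule: infinite_finite_induct) (auto intro: bounded_rv_const bounded_rv_add)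

lemma bounded_rv_power2: "bounded_rv p F \<Longrightarrow> bounded_rv p (\<lambda>\<omega>. (F \<omega>)\<^sup>2)"
  unfolding power2_eq_square by (rule bounded_rv_mult)

lemma bounded_rv_lam_real: "bounded_rv p (\<lambda>\<omega>. lam_real \<omega> y)" and bounded_rv_rho_real: "bounded_rv p (\<lambda>\<omega>. rho_real \<omega> y)"
  unfolding bounded_rv_def env_measure_def
  by (intro conjI lam_real_measurable rho_real_measurable exI[of _ 1]; auto simp: lam_real_def rho_real_def)+

lemma bounded_rv_integrable: "bounded_rv p F \<Longrightarrow> integrable (env_measure p) F"
proof -
  interpret prob_space "env_measure p" by (rule prob_space_env)
  assume "bounded_rv p F"
  then obtain c where "F \<in> borel_measurable (env_measure p)" "\<And>\<omega>. \<bar>F \<omega>\<bar> \<le> c" by (auto simp: bounded_rv_def)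
  then show ?thesis by (intro integrable_const_bound[of _ c]) auto
qed

lemmas bounded_rv_intros = bounded_rv_const bounded_rv_add bounded_rv_mult bounded_rv_sum bounded_rv_power2 bounded_rv_lam_real bounded_rv_rho_real

text \<open>The flip preserves the measure and negates the integrand, so the integral is its own
  negative. This stands in for conditioning on all variables but one sign.\<close>

lemma flip_odd_integral:
  assumes "bounded_rv p W" "\<And>\<omega>. W (flip y \<omega>) = W \<omega>"
  shows "(\<integral>\<omega>. rho_real \<omega> y * W \<omega> \<partial>env_measure p) = 0"
proof -
  have "(\<integral>\<omega>. rho_real \<omega> y * W \<omega> \<partial>env_measure p) = (\<integral>\<omega>. rho_real \<omega> y * W \<omega> \<partial>distr (env_measure p) (env_measure p) (flip y))"
    by (simp add: flip_measure_preserving)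
  also have "\<dots> = (\<integral>\<omega>. rho_real (flip y \<omega>) y * W (flip y \<omega>) \<partial>env_measure p)"
    using bounded_rv_mult[OF bounded_rv_rho_real assms(1)] flip_measurable by (intro integral_distr) (auto simp: bounded_rv_def)
  also have "\<dots> = - (\<integral>\<omega>. rho_real \<omega> y * W \<omega> \<partial>env_measure p)"
    by (simp add: rho_real_flip assms(2))
  finally show ?thesis by simp
qed

text \<open>The cutoff \<open>h\<close> may depend on the random sites but not on their signs, so that it keeps the signs orthogonal.\<close>

lemma flip_bessel:
  assumes "finite B" and bounded_rv: "bounded_rv p A" "bounded_rv p h"
    and inv: "\<And>x \<omega>. x \<in> B \<Longrightarrow> A (flip x \<omega>) = A \<omega>" "\<And>x \<omega>. h (flip x \<omega>) = h \<omega>"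
    and h0: "\<And>\<omega>. 0 \<le> h \<omega>"
  shows "(\<Sum>x\<in>B. (g x)\<^sup>2 * (\<integral>\<omega>. lam_real \<omega> x * h \<omega> \<partial>env_measure p))
    \<le> (\<integral>\<omega>. (A \<omega> + (\<Sum>x\<in>B. lam_real \<omega> x * rho_real \<omega> x * g x))\<^sup>2 * h \<omega> \<partial>env_measure p)"
  using assms(1) inv(1)
proof (induction B)
  case empty
  show ?case by (auto intro!: integral_nonneg simp: h0)
next
  case (insert x B)
  define Z where "Z \<omega> = A \<omega> + (\<Sum>x\<in>B. lam_real \<omega> x * rho_real \<omega> x * g x)" for \<omega>
  have bmZ: "bounded_rv p Z" unfolding Z_def by (intro bounded_rv_intros bounded_rv)
  have Zinv: "Z (flip x \<omega>) = Z \<omega>" for \<omega>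
    unfolding Z_def using insert by (auto simp: rho_real_flip intro!: sum.cong)
  have sq: "lam_real \<omega> x * lam_real \<omega> x = lam_real \<omega> x" "rho_real \<omega> x * rho_real \<omega> x = 1" for \<omega>
    by (auto simp: lam_real_def rho_real_def)
  \<comment> \<open>Expanding around the new site: the cross term is odd under \<open>flip x\<close>
    and integrates to 0, and the square no longer contains the sign.\<close>
  have "(A \<omega> + (\<Sum>x\<in>insert x B. lam_real \<omega> x * rho_real \<omega> x * g x))\<^sup>2 * h \<omega>
     = (Z \<omega>)\<^sup>2 * h \<omega> + (2 * g x) * (rho_real \<omega> x * (lam_real \<omega> x * Z \<omega> * h \<omega>)) + (g x)\<^sup>2 * (lam_real \<omega> x * h \<omega>)" for \<omega>
  proof -
    have "A \<omega> + (\<Sum>x\<in>insert x B. lam_real \<omega> x * rho_real \<omega> x * g x) = Z \<omega> + lam_real \<omega> x * rho_real \<omega> x * g x"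
      using insert by (simp add: Z_def)
    moreover have "(lam_real \<omega> x * rho_real \<omega> x * g x)\<^sup>2 = (g x)\<^sup>2 * lam_real \<omega> x"
      using sq[of \<omega>] by (simp add: power2_eq_square) (metis (no_types, lifting) mult.assoc mult.commute mult.right_neutral)
    ultimately show ?thesis by (simp add: power2_sum algebra_simps)
  qed
  then have "(\<integral>\<omega>. (A \<omega> + (\<Sum>x\<in>insert x B. lam_real \<omega> x * rho_real \<omega> x * g x))\<^sup>2 * h \<omega> \<partial>env_measure p)
     = (\<integral>\<omega>. (Z \<omega>)\<^sup>2 * h \<omega> + (2 * g x) * (rho_real \<omega> x * (lam_real \<omega> x * Z \<omega> * h \<omega>)) + (g x)\<^sup>2 * (lam_real \<omega> x * h \<omega>) \<partial>env_measure p)"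
    by simp
  also have "\<dots> = (\<integral>\<omega>. (Z \<omega>)\<^sup>2 * h \<omega> \<partial>env_measure p) + (2 * g x) * (\<integral>\<omega>. rho_real \<omega> x * (lam_real \<omega> x * Z \<omega> * h \<omega>) \<partial>env_measure p)
     + (g x)\<^sup>2 * (\<integral>\<omega>. lam_real \<omega> x * h \<omega> \<partial>env_measure p)"
    by (subst Bochner_Integration.integral_add, intro bounded_rv_integrable bounded_rv_intros bounded_rv bmZ, intro bounded_rv_integrable bounded_rv_intros bounded_rv bmZ,
        subst Bochner_Integration.integral_add, intro bounded_rv_integrable bounded_rv_intros bounded_rv bmZ, intro bounded_rv_integrable bounded_rv_intros bounded_rv bmZ) simp
  also have "(\<integral>\<omega>. rho_real \<omega> x * (lam_real \<omega> x * Z \<omega> * h \<omega>) \<partial>env_measure p) = 0"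
    by (rule flip_odd_integral) (auto intro!: bounded_rv_intros bounded_rv bmZ simp: Zinv inv)
  finally show ?case using insert unfolding Z_def by simp
qed

section \<open>Moments of the random-site indicators\<close>

lemma expect_site:
  fixes h :: "bool \<times> bool \<Rightarrow> real"
  shows "(\<integral>\<omega>. h (\<omega> y) \<partial>env_measure p) = measure_pmf.expectation (pair_pmf (bernoulli_pmf (p y)) (bernoulli_pmf (1/2))) h"
proof -
  interpret P: product_prob_space "site p" UNIV
    by (intro product_prob_spaceI prob_space_measure_pmf)
  have "(\<integral>\<omega>. h (\<omega> y) \<partial>env_measure p) = (\<integral>v. h v \<partial>distr (env_measure p) (site p y) (\<lambda>\<omega>. \<omega> y))"
    by (intro integral_distr[symmetric]) (auto simp: env_measure_def)
  also have "distr (env_measure p) (site p y) (\<lambda>\<omega>. \<omega> y) = site p y"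
    by (simp add: env_measure_def P.PiM_component)
  finally show ?thesis .
qed

lemma expect_lam_real:
  assumes "0 \<le> p y" "p y \<le> 1"
  shows "(\<integral>\<omega>. lam_real \<omega> y \<partial>env_measure p) = p y"
proof -
  have "(\<integral>\<omega>. lam_real \<omega> y \<partial>env_measure p) = measure_pmf.expectation (pair_pmf (bernoulli_pmf (p y)) (bernoulli_pmf (1/2))) (\<lambda>v. of_bool (fst v))"
    unfolding lam_real_def by (rule expect_site)
  also have "\<dots> = measure_pmf.expectation (map_pmf fst (pair_pmf (bernoulli_pmf (p y)) (bernoulli_pmf (1/2)))) of_bool"
    by (simp only: integral_map_pmf)
  also have "\<dots> = p y" using assms by (simp add: map_fst_pair_pmf)
  finally show ?thesis .
qed

lemma expect_lam_real_mult:
  assumes "x \<noteq> y" "\<And>y. 0 \<le> p y \<and> p y \<le> 1"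
  shows "(\<integral>\<omega>. lam_real \<omega> x * lam_real \<omega> y \<partial>env_measure p) = p x * p y"
proof -
  interpret prob_space "env_measure p" by (rule prob_space_env)
  have "indep_vars (\<lambda>_. borel) (\<lambda>i \<omega>. (\<lambda>v. of_bool (fst v) :: real) (\<omega> i)) UNIV"
    by (rule indep_vars_compose2[OF indep_coords]) auto
  then have "indep_vars (\<lambda>_. borel) (\<lambda>i \<omega>. lam_real \<omega> i) {x, y}"
    unfolding lam_real_def by (rule indep_vars_subset) auto
  then have "(\<integral>\<omega>. (\<Prod>i\<in>{x, y}. lam_real \<omega> i) \<partial>env_measure p) = (\<Prod>i\<in>{x, y}. \<integral>\<omega>. lam_real \<omega> i \<partial>env_measure p)"
    by (intro indep_vars_lebesgue_integral) (auto intro: bounded_rv_integrable bounded_rv_lam_real)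
  then show ?thesis using assms by (simp add: expect_lam_real)
qed

section \<open>Fluctuations in blocks\<close>

text \<open>\<open>c\<close> is separate from \<open>k\<close> because the induction runs over the
  range while the parabola stays fixed; the use is \<open>c = k\<close>.\<close>

lemma sum_sq_parabola:
  fixes c :: real
  shows "30 * (\<Sum>i<k. (real i * (c - real i))\<^sup>2) = 5 * c\<^sup>2 * (real k - 1) * k * (2 * real k - 1)
     - 15 * c * (real k * (real k - 1))\<^sup>2 + real k * (real k - 1) * (2 * real k - 1) * (3 * (real k)\<^sup>2 - 3 * real k - 1)"
proof (induction k)
  case (Suc k)
  show ?case unfolding sum.lessThan_Suc distrib_left Suc of_nat_Suc
    by (simp add: power2_eq_square algebra_simps)
qed simp

text \<open>The sum equals \<open>n * (n^4 - 1) / (30 * n^4)\<close>, and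
  \<open>n^4 \<ge> 16\<close> gives the factor \<open>1/64\<close>.\<close>

lemma bump_sum_sq:
  assumes "2 \<le> n"
  shows "real n / 64 \<le> (\<Sum>x\<in>block a n. (bump a n x)\<^sup>2)"
proof -
  have "(\<Sum>x\<in>block a n. (bump a n x)\<^sup>2) = (\<Sum>i<n. (real i * (real n - real i))\<^sup>2 / (real n) ^ 4)"
    by (rule sum.reindex_bij_witness[of _ "\<lambda>i. a + int i" "\<lambda>x. nat (x - a)"])
       (auto simp: block_def bump_def power_divide power_mult[symmetric])
  also have "\<dots> = (30 * (\<Sum>i<n. (real i * (real n - real i))\<^sup>2)) / (30 * (real n) ^ 4)"
    by (simp add: sum_divide_distrib)
  also have "30 * (\<Sum>i<n. (real i * (real n - real i))\<^sup>2) = real n * (real n ^ 4 - 1)"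
    unfolding sum_sq_parabola by (simp add: power2_eq_square power4_eq_xxxx algebra_simps)
  also have "real n / 64 \<le> real n * (real n ^ 4 - 1) / (30 * (real n) ^ 4)"
  proof -
    have "(2::real) ^ 4 \<le> real n ^ 4" using assms by (intro power_mono) auto
    then have "real n * (30 * real n ^ 4) \<le> real n * (64 * (real n ^ 4 - 1))" by (intro mult_left_mono) auto
    then show ?thesis using assms by (simp add: field_simps)
  qed
  finally show ?thesis .
qed

lemma sum_diff_mult:
  fixes S g :: "int \<Rightarrow> real"
  assumes "y \<le> b + 1"
  shows "(\<Sum>x\<in>{y..b}. (S x - S (x-1)) * g x) = S b * g (b+1) - S (y-1) * g y - (\<Sum>x\<in>{y..b}. S x * (g (x+1) - g x))"
proof -
  have "y - 1 \<le> b" using assms by simp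
  then show ?thesis
  proof (induction b rule: int_ge_induct)
    case (step b)
    have "{y..b+1} = insert (b+1) {y..b}" using step.hyps by auto
    then show ?case using step.IH by (simp add: algebra_simps)
  qed simp
qed

text \<open>\<open>S\<close> is a bounded discrete antiderivative of \<open>f\<close>, the form in
  which periodicity and balance enter the block estimates.\<close>

locale env =
  fixes p :: "int \<Rightarrow> real" and f :: "int \<Rightarrow> int" and S :: "int \<Rightarrow> real" and F :: real
  assumes p01: "\<And>y. 0 \<le> p y \<and> p y \<le> 1" and f: "\<And>y. f y \<in> {-1, 1}"
    and S: "\<And>y. S y - S (y-1) = f y" "\<And>y. \<bar>S y\<bar> \<le> F"
begin

definition site_count :: "int \<Rightarrow> nat \<Rightarrow> (int \<Rightarrow> bool \<times> bool) \<Rightarrow> real" where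
  "site_count a n \<omega> = (\<Sum>x\<in>block a n. lam_real \<omega> x)"

text \<open>The cutoff makes the variable bounded, as Hoeffding's inequality demands. It counts
  random sites and ignores their signs.\<close>

definition block_energy :: "real \<Rightarrow> int \<Rightarrow> nat \<Rightarrow> (int \<Rightarrow> bool \<times> bool) \<Rightarrow> real" where
  "block_energy m a n \<omega> = (tailsum (eps_of f \<omega>) a n a)\<^sup>2 * (if site_count a n \<omega> \<le> m then 1 else 0)"

lemma F_nonneg: "0 \<le> F" using S(2)[of 0] by linarith

lemma eps_pm: "eps_of f \<omega> y \<in> {-1, 1}"
  using f[of y] by (auto simp: eps_of_def lam_of_def rho_of_def)

lemma site_count_nonneg: "0 \<le> site_count a n \<omega>" by (simp add: site_count_def lam_real_def sum_nonneg)

text \<open>The periodic part is summed by parts against the bump: \<open>F\<close> from its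
  increments of size \<open>1 / n\<close> and \<open>F\<close> from the left boundary. Each random
  site then alters the sum by at most 2.\<close>

lemma tailsum_le:
  assumes "0 < n" "a \<le> y" "y \<le> a + int n"
  shows "\<bar>tailsum (eps_of f \<omega>) a n y\<bar> \<le> 2 * F + 2 * site_count a n \<omega>"
proof -
  let ?b = "a + int n - 1"
  let ?g = "bump a n"
  have sub: "{y..?b} \<subseteq> block a n" using assms by (auto simp: block_def)
  have eq: "tailsum (eps_of f \<omega>) a n y = (\<Sum>x\<in>{y..?b}. (S x - S (x-1)) * ?g x) + (\<Sum>x\<in>{y..?b}. lam_real \<omega> x * (rho_real \<omega> x - f x) * ?g x)"
    unfolding tailsum_def eps_of_real S(1) sum.distrib[symmetric] by (intro sum.cong) (auto simp: algebra_simps)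
  have Sg: "\<bar>S x * w\<bar> \<le> F * c" if "\<bar>w\<bar> \<le> c" for x w c
    unfolding abs_mult using S(2)[of x] that F_nonneg by (intro mult_mono) auto
  have "\<bar>\<Sum>x\<in>{y..?b}. S x * (?g (x+1) - ?g x)\<bar> \<le> (\<Sum>x\<in>{y..?b}. F * (1 / n))"
    by (rule order_trans[OF sum_abs]) (intro sum_mono Sg bump_diff, use assms in auto)
  also have "\<dots> \<le> (\<Sum>x\<in>block a n. F * (1 / n))" using sub F_nonneg by (intro sum_mono2) (auto simp: block_def)
  also have "\<dots> = F" using assms by (simp add: block_def)
  finally have 1: "\<bar>\<Sum>x\<in>{y..?b}. S x * (?g (x+1) - ?g x)\<bar> \<le> F" .
  have 2: "\<bar>S (y-1) * ?g y\<bar> \<le> F * 1" using bump_bounds[of n a y] assms by (intro Sg) auto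
  have 3: "?g (?b + 1) = 0" by (simp add: bump_def)
  have 4: "\<bar>\<Sum>x\<in>{y..?b}. (S x - S (x-1)) * ?g x\<bar> \<le> 2 * F"
    using 1 2 3 assms by (subst sum_diff_mult) auto
  have "\<bar>\<Sum>x\<in>{y..?b}. lam_real \<omega> x * (rho_real \<omega> x - f x) * ?g x\<bar> \<le> (\<Sum>x\<in>{y..?b}. lam_real \<omega> x * 2 * 1)"
  proof (rule order_trans[OF sum_abs], rule sum_mono)
    fix x assume x: "x \<in> {y..?b}"
    have "\<bar>rho_real \<omega> x - f x\<bar> \<le> 2" using f[of x] by (auto simp: rho_real_def)
    then show "\<bar>lam_real \<omega> x * (rho_real \<omega> x - f x) * ?g x\<bar> \<le> lam_real \<omega> x * 2 * 1"
      unfolding abs_mult using bump_bounds[of n a x] x assms by (intro mult_mono) (auto simp: lam_real_def)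
  qed
  also have "\<dots> \<le> (\<Sum>x\<in>block a n. lam_real \<omega> x * 2 * 1)"
    using sub by (intro sum_mono2) (auto simp: block_def lam_real_def)
  also have "\<dots> = 2 * site_count a n \<omega>" by (simp add: site_count_def sum_distrib_left mult.commute)
  finally show ?thesis unfolding eq using 4 by linarith
qed

lemma site_count_measurable:
  "block a n \<subseteq> I \<Longrightarrow> site_count a n \<in> borel_measurable (PiM I (site p))"
  unfolding site_count_def[abs_def] by (intro borel_measurable_sum lam_real_measurable) auto

lemma block_energy_measurable:
  assumes "block a n \<subseteq> I"
  shows "block_energy m a n \<in> borel_measurable (PiM I (site p))"
proof -
  have [measurable]: "site_count a n \<in> borel_measurable (PiM I (site p))" by (rule site_count_measurable[OF assms])
  have [measurable]: "(\<lambda>\<omega>. tailsum (eps_of f \<omega>) a n a) \<in> borel_measurable (PiM I (site p))"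
    unfolding tailsum_def eps_of_real
    by (intro borel_measurable_sum borel_measurable_times borel_measurable_add borel_measurable_diff
        borel_measurable_const lam_real_measurable rho_real_measurable) (use assms in \<open>auto simp: block_def\<close>)
  show ?thesis unfolding block_energy_def[abs_def] by measurable
qed

lemma block_energy_bounds:
  assumes "0 < n" "0 \<le> m"
  shows "0 \<le> block_energy m a n \<omega>" "block_energy m a n \<omega> \<le> (2 * F + 2 * m)\<^sup>2"
proof -
  show "0 \<le> block_energy m a n \<omega>" by (simp add: block_energy_def)
  show "block_energy m a n \<omega> \<le> (2 * F + 2 * m)\<^sup>2"
  proof (cases "site_count a n \<omega> \<le> m")
    case True
    have "\<bar>tailsum (eps_of f \<omega>) a n a\<bar> \<le> \<bar>2 * F + 2 * m\<bar>"
      using tailsum_le[of n a a \<omega>] True assms F_nonneg by auto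
    then show ?thesis using True unfolding abs_le_square_iff by (simp add: block_energy_def)
  qed (simp add: block_energy_def)
qed

text \<open>Markov's inequality weighted by \<open>lam_real \<omega> x\<close>: given a random site
  at \<open>x\<close>, the expected count is at most \<open>1 + n * pmax\<close>, half of
  \<open>m\<close>. So the cutoff keeps at least half of the probability of that site.\<close>

lemma expect_lam_real_cutoff:
  assumes m: "m = 2 * (1 + real n * pmax)" and pmax: "\<And>x. x \<in> block a n \<Longrightarrow> p x \<le> pmax" "0 \<le> pmax" and x: "x \<in> block a n"
  shows "p x / 2 \<le> (\<integral>\<omega>. lam_real \<omega> x * (if site_count a n \<omega> \<le> m then 1 else 0) \<partial>env_measure p)"
proof -
  have m0: "0 < m" using m pmax by (simp add: add_pos_nonneg)
  have fin: "finite (block a n)" by (simp add: block_def)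
  have bmcnt: "bounded_rv p (site_count a n)" unfolding site_count_def[abs_def] by (intro bounded_rv_intros)
  have bmh: "bounded_rv p (\<lambda>\<omega>. if site_count a n \<omega> \<le> m then 1 else 0)"
  proof -
    have [measurable]: "site_count a n \<in> borel_measurable (env_measure p)" using bmcnt by (simp add: bounded_rv_def)
    show ?thesis unfolding bounded_rv_def by (intro conjI exI[of _ 1]) auto
  qed
  have "(\<integral>\<omega>. lam_real \<omega> x * site_count a n \<omega> \<partial>env_measure p) = (\<Sum>y\<in>block a n. \<integral>\<omega>. lam_real \<omega> x * lam_real \<omega> y \<partial>env_measure p)"
    unfolding site_count_def sum_distrib_left by (intro Bochner_Integration.integral_sum bounded_rv_integrable bounded_rv_intros)
  also have "\<dots> = (\<integral>\<omega>. lam_real \<omega> x * lam_real \<omega> x \<partial>env_measure p) + (\<Sum>y\<in>block a n - {x}. \<integral>\<omega>. lam_real \<omega> x * lam_real \<omega> y \<partial>env_measure p)"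
    using x fin by (simp add: sum.remove)
  also have "(\<lambda>\<omega>. lam_real \<omega> x * lam_real \<omega> x) = (\<lambda>\<omega>. lam_real \<omega> x)" by (auto simp: lam_real_def)
  also have "(\<integral>\<omega>. lam_real \<omega> x \<partial>env_measure p) = p x" using p01 by (simp add: expect_lam_real)
  also have "(\<Sum>y\<in>block a n - {x}. \<integral>\<omega>. lam_real \<omega> x * lam_real \<omega> y \<partial>env_measure p) = (\<Sum>y\<in>block a n - {x}. p x * p y)"
    using p01 by (intro sum.cong refl expect_lam_real_mult) auto
  also have "\<dots> \<le> (\<Sum>y\<in>block a n - {x}. p x * pmax)" using p01 pmax by (intro sum_mono mult_left_mono) auto
  also have "\<dots> \<le> (\<Sum>y\<in>block a n. p x * pmax)" using p01 pmax fin by (intro sum_mono2) auto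
  also have "\<dots> = n * pmax * p x" by (simp add: block_def)
  finally have 1: "(\<integral>\<omega>. lam_real \<omega> x * site_count a n \<omega> \<partial>env_measure p) \<le> p x * (m / 2)" unfolding m by (simp add: algebra_simps)
  have "p x / 2 = p x - p x * (m / 2) / m" using m0 by simp
  also have "\<dots> \<le> p x - (\<integral>\<omega>. lam_real \<omega> x * site_count a n \<omega> \<partial>env_measure p) / m"
    using 1 m0 by (intro diff_left_mono divide_right_mono) auto
  also have "\<dots> = (\<integral>\<omega>. lam_real \<omega> x \<partial>env_measure p) - (\<integral>\<omega>. lam_real \<omega> x * site_count a n \<omega> * (1 / m) \<partial>env_measure p)"
    using p01 by (simp add: expect_lam_real)
  also have "\<dots> = (\<integral>\<omega>. lam_real \<omega> x - lam_real \<omega> x * site_count a n \<omega> * (1 / m) \<partial>env_measure p)"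
    by (rule Bochner_Integration.integral_diff[symmetric]) (intro bounded_rv_integrable bounded_rv_intros bmcnt)+
  also have "\<dots> \<le> (\<integral>\<omega>. lam_real \<omega> x * (if site_count a n \<omega> \<le> m then 1 else 0) \<partial>env_measure p)"
  proof (rule integral_mono)
    show "integrable (env_measure p) (\<lambda>\<omega>. lam_real \<omega> x - lam_real \<omega> x * site_count a n \<omega> * (1 / m))"
      by (intro Bochner_Integration.integrable_diff bounded_rv_integrable bounded_rv_intros bmcnt)
    show "integrable (env_measure p) (\<lambda>\<omega>. lam_real \<omega> x * (if site_count a n \<omega> \<le> m then 1 else 0))"
      by (intro bounded_rv_integrable bounded_rv_mult bounded_rv_lam_real bmh)
    fix \<omega>
    \<comment> \<open>Pointwise, \<open>1 - u / m\<close> lies below the indicator of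
      \<open>u \<le> m\<close> for \<open>u \<ge> 0\<close>.\<close>
    show "lam_real \<omega> x - lam_real \<omega> x * site_count a n \<omega> * (1 / m) \<le> lam_real \<omega> x * (if site_count a n \<omega> \<le> m then 1 else 0)"
      using site_count_nonneg[of a n \<omega>] m0 by (auto simp: lam_real_def)
  qed
  finally show ?thesis .
qed

text \<open>The orthogonal signs give a lower bound whatever the sign-free part \<open>A\<close> is.
  The constant is \<open>1/2\<close> from the cutoff times \<open>1/64\<close> from the
  bump.\<close>

lemma expect_block_energy:
  assumes n: "2 \<le> n" and m: "m = 2 * (1 + real n * pmax)" and pmin: "0 \<le> pmin"
    and p: "\<And>x. x \<in> block a n \<Longrightarrow> pmin \<le> p x \<and> p x \<le> pmax"
  shows "pmin * n / 128 \<le> (\<integral>\<omega>. block_energy m a n \<omega> \<partial>env_measure p)"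
proof -
  have "a \<in> block a n" using n by (auto simp: block_def)
  then have pmax: "0 \<le> pmax" using p[of a] pmin by linarith
  have bmcnt: "bounded_rv p (site_count a n)" unfolding site_count_def[abs_def] by (intro bounded_rv_intros)
  define h where "h \<omega> = (if site_count a n \<omega> \<le> m then 1 else 0 :: real)" for \<omega>
  have bmh: "bounded_rv p h"
  proof -
    have [measurable]: "site_count a n \<in> borel_measurable (env_measure p)" using bmcnt by (simp add: bounded_rv_def)
    show ?thesis unfolding bounded_rv_def h_def[abs_def] by (intro conjI exI[of _ 1]) auto
  qed
  define A where "A \<omega> = (\<Sum>x\<in>block a n. (1 + (-1) * lam_real \<omega> x) * (f x * bump a n x))" for \<omega>
  have bmA: "bounded_rv p A" unfolding A_def by (intro bounded_rv_intros)
  have T: "tailsum (eps_of f \<omega>) a n a = A \<omega> + (\<Sum>x\<in>block a n. lam_real \<omega> x * rho_real \<omega> x * bump a n x)" for \<omega>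
    unfolding tailsum_def eps_of_real A_def sum.distrib[symmetric] block_def by (intro sum.cong) (auto simp: algebra_simps)
  have hflip: "h (flip x \<omega>) = h \<omega>" for x \<omega> by (simp add: h_def site_count_def)
  have "pmin * n / 128 = pmin / 2 * (real n / 64)" by simp
  also have "\<dots> \<le> pmin / 2 * (\<Sum>x\<in>block a n. (bump a n x)\<^sup>2)"
    using n pmin by (intro mult_left_mono bump_sum_sq) auto
  also have "\<dots> = (\<Sum>x\<in>block a n. (bump a n x)\<^sup>2 * (pmin / 2))" by (simp add: sum_distrib_left mult.commute)
  also have "\<dots> \<le> (\<Sum>x\<in>block a n. (bump a n x)\<^sup>2 * (\<integral>\<omega>. lam_real \<omega> x * h \<omega> \<partial>env_measure p))"
  proof (intro sum_mono mult_left_mono)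
    fix x assume x: "x \<in> block a n"
    have "pmin / 2 \<le> p x / 2" using p[OF x] by simp
    also have "\<dots> \<le> (\<integral>\<omega>. lam_real \<omega> x * h \<omega> \<partial>env_measure p)"
      unfolding h_def by (rule expect_lam_real_cutoff[OF m]) (use p x pmax in auto)
    finally show "pmin / 2 \<le> (\<integral>\<omega>. lam_real \<omega> x * h \<omega> \<partial>env_measure p)" .
  qed auto
  also have "\<dots> \<le> (\<integral>\<omega>. (A \<omega> + (\<Sum>x\<in>block a n. lam_real \<omega> x * rho_real \<omega> x * bump a n x))\<^sup>2 * h \<omega> \<partial>env_measure p)"
    by (rule flip_bessel[OF _ bmA bmh _ hflip]) (auto simp: block_def A_def h_def)
  finally show ?thesis by (simp add: block_energy_def h_def T)
qed

lemma indep_block_energy: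
  assumes "0 < n"
  shows "prob_space.indep_vars (env_measure p) (\<lambda>_. borel) (\<lambda>j. block_energy m (int ((N + j) * n)) n) J"
proof -
  interpret prob_space "env_measure p" by (rule prob_space_env)
  let ?K = "\<lambda>j. block (int ((N + j) * n)) n"
  have "indep_vars (\<lambda>j. PiM (?K j) (site p)) (\<lambda>j \<omega>. restrict (\<lambda>i. \<omega> i) (?K j)) J"
    by (intro indep_vars_restrict[OF indep_coords] disjoint_shifted_blocks assms) auto
  then have "indep_vars (\<lambda>_. borel) (\<lambda>j \<omega>. block_energy m (int ((N + j) * n)) n (restrict (\<lambda>i. \<omega> i) (?K j))) J"
    by (rule indep_vars_compose2) (rule block_energy_measurable, simp)
  moreover have "block_energy m a n (restrict (\<lambda>i. \<omega> i) (block a n)) = block_energy m a n \<omega>" for a \<omega>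
    unfolding block_energy_def site_count_def tailsum_def eps_of_real
    by (intro arg_cong2[where f="(*)"] arg_cong[where f="\<lambda>x. x\<^sup>2"] sum.cong refl if_cong arg_cong2[where f="(\<le>)"])
       (auto simp: lam_real_def rho_real_def block_def)
  ultimately show ?thesis by simp
qed

definition block_cap :: "real \<Rightarrow> real" where "block_cap m = 2 * F + 2 * m"

text \<open>The index set consists of the blocks that pass the cutoff; the others have block energy
  0.\<close>

lemma good_blocks_of_sum:
  assumes n: "0 < n" and m: "1 \<le> m" and W: "(block_cap m)\<^sup>2 \<le> real N * W"
    and sum: "W < (\<Sum>j<N. block_energy m (int ((N + j) * n)) n \<omega>)"
  shows "good_blocks (eps_of f \<omega>) n N W"
  unfolding good_blocks_def
proof (intro exI conjI)
  let ?a = "\<lambda>j. int ((N + j) * n)"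
  let ?J = "{j \<in> {..<N}. site_count (?a j) n \<omega> \<le> m}"
  show "?J \<subseteq> {..<N}" by auto
  show "1 \<le> block_cap m" using F_nonneg m by (simp add: block_cap_def)
  show "(block_cap m)\<^sup>2 \<le> real N * W" by (rule W)
  show "\<forall>j\<in>?J. \<forall>y\<in>block (?a j) n. \<bar>tailsum (eps_of f \<omega>) (?a j) n (y+1)\<bar> \<le> block_cap m"
  proof (intro ballI)
    fix j y assume j: "j \<in> ?J" and y: "y \<in> block (?a j) n"
    have "\<bar>tailsum (eps_of f \<omega>) (?a j) n (y+1)\<bar> \<le> 2 * F + 2 * site_count (?a j) n \<omega>"
      by (rule tailsum_le) (use n y in \<open>auto simp: block_def\<close>)
    then show "\<bar>tailsum (eps_of f \<omega>) (?a j) n (y+1)\<bar> \<le> block_cap m" using j by (simp add: block_cap_def)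
  qed
  have "(\<Sum>j<N. block_energy m (?a j) n \<omega>) = (\<Sum>j\<in>?J. (tailsum (eps_of f \<omega>) (?a j) n (?a j))\<^sup>2)"
    unfolding block_energy_def by (subst sum.inter_filter) (auto intro!: sum.cong)
  then show "W \<le> (\<Sum>j\<in>?J. (tailsum (eps_of f \<omega>) (?a j) n (?a j))\<^sup>2)" using sum by simp
qed

text \<open>Hoeffding's inequality for a deviation down to half the lower bound of the mean, hence
  256 for 128, with summands in \<open>{0..(block_cap m)^2}\<close>.\<close>

lemma prob_bad_le:
  assumes n: "2 \<le> n" and N: "0 < N" and m: "m = 2 * (1 + real n * pmax)" and pmin: "0 \<le> pmin"
    and p: "\<And>x. int (N * n) \<le> x \<Longrightarrow> x \<le> int (2 * N * n) \<Longrightarrow> pmin \<le> p x \<and> p x \<le> pmax"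
  shows "measure (env_measure p) {\<omega>. (\<Sum>j<N. block_energy m (int ((N + j) * n)) n \<omega>) \<le> N * (pmin * n / 256)}
    \<le> exp (- 2 * (N * (pmin * n / 256))\<^sup>2 / (N * (block_cap m) ^ 4))"
proof -
  let ?a = "\<lambda>j. int ((N + j) * n)"
  let ?X = "\<lambda>j. block_energy m (?a j) n"
  have "pmin \<le> p (int (N * n)) \<and> p (int (N * n)) \<le> pmax" using N by (intro p) auto
  then have pmax: "0 \<le> pmax" using pmin by linarith
  have m1: "1 \<le> m" using pmax m by simp
  interpret prob_space "env_measure p" by (rule prob_space_env)
  define \<mu> where "\<mu> = (\<Sum>j<N. expectation (?X j))"
  interpret Hoeffding_ineq "env_measure p" "{..<N}" ?X "\<lambda>_. 0" "\<lambda>_. (block_cap m)\<^sup>2" \<mu>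
  proof unfold_locales
    show "indep_vars (\<lambda>_. borel) ?X {..<N}" using n by (intro indep_block_energy) auto
    show "AE x in env_measure p. ?X i x \<in> {0..(block_cap m)\<^sup>2}" for i
      using block_energy_bounds[of n m] n m1 by (simp add: block_cap_def)
  qed (simp_all add: \<mu>_def)
  have blkp: "pmin \<le> p x \<and> p x \<le> pmax" if "j < N" "x \<in> block (?a j) n" for j x
  proof (rule p)
    have "N * n \<le> (N + j) * n" by simp
    then have "int (N * n) \<le> ?a j" by (rule zle_int[THEN iffD2])
    then show "int (N * n) \<le> x" using that(2) unfolding block_def atLeastAtMost_iff by linarith
    have "?a j + int n \<le> int (2 * N * n)" by (rule shifted_block_end[OF that(1)])
    then show "x \<le> int (2 * N * n)" using that(2) unfolding block_def atLeastAtMost_iff by linarith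
  qed
  have "(\<Sum>j<N. pmin * n / 128) \<le> \<mu>" unfolding \<mu>_def
  proof (rule sum_mono)
    fix j assume "j \<in> {..<N}"
    then show "pmin * n / 128 \<le> expectation (?X j)"
      by (intro expect_block_energy[OF n m pmin] blkp) auto
  qed
  then have \<mu>: "N * (pmin * n / 256) \<le> \<mu> - N * (pmin * n / 256)" by (simp add: mult_ac)
  have Mb0: "0 < block_cap m" using m1 F_nonneg by (simp add: block_cap_def)
  have meas: "?X j \<in> borel_measurable (env_measure p)" for j
    unfolding env_measure_def by (rule block_energy_measurable) simp
  have "measure (env_measure p) {\<omega>. (\<Sum>j<N. ?X j \<omega>) \<le> N * (pmin * n / 256)}
     \<le> measure (env_measure p) {\<omega>\<in>space (env_measure p). (\<Sum>j<N. ?X j \<omega>) \<le> \<mu> - N * (pmin * n / 256)}"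
  proof (rule finite_measure_mono)
    show "{\<omega>. (\<Sum>j<N. ?X j \<omega>) \<le> N * (pmin * n / 256)}
        \<subseteq> {\<omega>\<in>space (env_measure p). (\<Sum>j<N. ?X j \<omega>) \<le> \<mu> - N * (pmin * n / 256)}"
      using order_trans[OF _ \<mu>] by (intro subsetI CollectI conjI) (simp_all only: mem_Collect_eq space_env UNIV_I)
    note meas[measurable]
    show "{\<omega>\<in>space (env_measure p). (\<Sum>j<N. ?X j \<omega>) \<le> \<mu> - N * (pmin * n / 256)} \<in> sets (env_measure p)"
      by measurable
  qed
  also have "\<dots> \<le> exp (-2 * (N * (pmin * n / 256))\<^sup>2 / (\<Sum>i<N. ((block_cap m)\<^sup>2 - 0)\<^sup>2))"
    using pmin Mb0 N by (intro Hoeffding_ineq_le) auto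
  also have "(\<Sum>i<N. ((block_cap m)\<^sup>2 - 0)\<^sup>2) = N * (block_cap m) ^ 4" by (simp flip: power_mult)
  finally show ?thesis .
qed

end

section \<open>Recurrence and transience\<close>

text \<open>Zero sum over a period makes the antiderivative itself periodic, so it has finitely many
  values.\<close>

lemma balanced_antiderivative:
  fixes f :: "int \<Rightarrow> int" and Q :: int
  assumes Q: "Q > 0" and per: "\<And>y. f (y + Q) = f y" and bal: "(\<Sum>y = 1..Q. f y) = 0"
  obtains S :: "int \<Rightarrow> real" and F where "\<And>y. S y - S (y-1) = f y" "\<And>y. \<bar>S y\<bar> \<le> F"
proof -
  define s where "s y = (if 0 \<le> y then \<Sum>x\<in>{1..y}. f x else - (\<Sum>x\<in>{y+1..0}. f x))" for y
  have d: "s y - s (y-1) = f y" for y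
  proof (cases "1 \<le> y")
    case True
    then have "{1..y} = insert y {1..y-1}" by auto
    then show ?thesis using True by (simp add: s_def)
  next
    case False
    then have "{y..0} = insert y {y+1..0}" by auto
    then have "(\<Sum>x\<in>{y..0}. f x) = f y + (\<Sum>x\<in>{y+1..0}. f x)" by simp
    then show ?thesis using False by (auto simp: s_def)
  qed
  have sQ: "s (y + Q) = s y" for y
  proof (induction y rule: int_induct[where k=0])
    case base
    show ?case using Q bal by (simp add: s_def)
  next
    case (step1 i)
    then show ?case using d[of "i + 1 + Q"] d[of "i + 1"] per[of "i + 1"] by (simp add: algebra_simps)
  next
    case (step2 i)
    then show ?case using d[of "i + Q"] d[of i] per[of i] by (simp add: algebra_simps)
  qed
  have per': "s (y + int k * Q) = s y" for y k
  proof (induction k)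
    case (Suc k)
    then show ?case using sQ[of "y + int k * Q"] by (simp add: algebra_simps)
  qed simp
  have smod: "s y = s (y mod Q)" for y
  proof (cases "0 \<le> y div Q")
    case True
    then show ?thesis using per'[of "y mod Q" "nat (y div Q)"] by simp
  next
    case False
    then show ?thesis using per'[of y "nat (- (y div Q))"] by (simp add: minus_div_mult_eq_mod)
  qed
  define F where "F = Max ((\<lambda>y. \<bar>s y\<bar>) ` {0..<Q})"
  have "\<bar>s y\<bar> \<le> F" for y
    unfolding F_def smod[of y] using Q by (intro Max_ge) auto
  then have "\<bar>real_of_int (s y)\<bar> \<le> real_of_int F" for y by (metis of_int_abs of_int_le_iff)
  moreover have "real_of_int (s y) - real_of_int (s (y-1)) = real_of_int (f y)" for y
    by (simp add: d flip: of_int_diff)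
  ultimately show ?thesis using that[of "\<lambda>y. real_of_int (s y)" "real_of_int F"] by blast
qed

text \<open>Each random line adds one jump to the antiderivative of \<open>f\<close>; finitely many
  jumps keep it bounded.\<close>

lemma (in env) recurrence_of_finite:
  assumes fin: "finite {y. fst (\<omega> y)}"
  shows "\<not> summable (\<lambda>n. walk_prob (eps_of f \<omega>) n (0,0) (0,0))"
proof -
  define d where "d y = real_of_int (eps_of f \<omega> y - f y)" for y
  define Y where "Y = {y. fst (\<omega> y)}"
  define S' where "S' y = S y + (\<Sum>x\<in>Y. if x \<le> y then d x else 0)" for y
  have d0: "d y = 0" if "y \<notin> Y" for y using that by (simp add: d_def Y_def eps_of_def lam_of_def)
  show ?thesis
  proof (rule recurrence_criterion)
    show "eps_of f \<omega> y \<in> {-1, 1}" for y by (rule eps_pm)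
    show "S' y - S' (y-1) = real_of_int (eps_of f \<omega> y)" for y
    proof -
      have "(\<Sum>x\<in>Y. if x \<le> y then d x else 0) - (\<Sum>x\<in>Y. if x \<le> y - 1 then d x else 0) = (\<Sum>x\<in>Y. if x = y then d x else 0)"
        unfolding sum_subtractf[symmetric] by (intro sum.cong) auto
      also have "\<dots> = d y" using fin d0[of y] by (simp add: Y_def)
      finally show ?thesis using S(1)[of y] by (simp add: S'_def d_def)
    qed
    show "\<bar>S' y\<bar> \<le> F + (\<Sum>x\<in>Y. \<bar>d x\<bar>)" for y
    proof -
      have "\<bar>\<Sum>x\<in>Y. if x \<le> y then d x else 0\<bar> \<le> (\<Sum>x\<in>Y. \<bar>d x\<bar>)"
        by (rule order_trans[OF sum_abs]) (auto intro: sum_mono)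
      then show ?thesis using S(2)[of y] unfolding S'_def by linarith
    qed
  qed
qed

lemma (in env) AE_finite_random_sites:
  assumes c: "0 < c" and \<beta>: "1 < \<beta>" and p: "\<And>y. \<bar>y\<bar> \<ge> N0 \<Longrightarrow> p y = c * real_of_int \<bar>y\<bar> powr (-\<beta>)"
  shows "AE \<omega> in env_measure p. finite {y. fst (\<omega> y)}"
proof -
  interpret prob_space "env_measure p" by (rule prob_space_env)
  \<comment> \<open>Heights \<open>n\<close> and \<open>- n\<close> are paired so that
    Borel-Cantelli runs over the natural numbers.\<close>
  define A where "A n = {\<omega>\<in>space (env_measure p). 1 \<le> lam_real \<omega> (int n) + lam_real \<omega> (- int n)}" for n
  have m: "(\<lambda>\<omega>. lam_real \<omega> y) \<in> borel_measurable (env_measure p)" for y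
    using bounded_rv_lam_real[of p y] by (simp add: bounded_rv_def)
  have A: "A n \<in> sets (env_measure p)" for n unfolding A_def using m by measurable
  have "measure (env_measure p) (A n) \<le> p (int n) + p (- int n)" for n
  proof -
    have int: "integrable (env_measure p) (\<lambda>\<omega>. lam_real \<omega> (int n) + lam_real \<omega> (- int n))"
      by (intro bounded_rv_integrable bounded_rv_intros)
    have "measure (env_measure p) (A n) \<le> (\<integral>\<omega>. lam_real \<omega> (int n) + lam_real \<omega> (- int n) \<partial>env_measure p) / 1"
      unfolding A_def by (rule integral_Markov_inequality_measure[where A="{}"])
        (use int in \<open>auto simp: lam_real_def\<close>)
    also have "\<dots> = p (int n) + p (- int n)"
      using p01 by (subst Bochner_Integration.integral_add) (auto simp: expect_lam_real intro: bounded_rv_integrable bounded_rv_lam_real)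
    finally show ?thesis .
  qed
  moreover have "p (int n) + p (- int n) = 2 * c * real n powr (-\<beta>)" if "n \<ge> nat N0" for n
    using p[of "int n"] p[of "- int n"] that by simp
  ultimately have le: "norm (measure (env_measure p) (A n)) \<le> 2 * c * real n powr (-\<beta>)" if "n \<ge> nat N0" for n
    using that by (metis measure_nonneg real_norm_def abs_of_nonneg)
  have "summable (\<lambda>n. 2 * c * real n powr (-\<beta>))"
    using \<beta> by (intro summable_mult) (simp add: summable_real_powr_iff)
  then have "summable (\<lambda>n. measure (env_measure p) (A n))"
    by (rule summable_comparison_test'[OF _ le])
  then have "AE \<omega> in env_measure p. eventually (\<lambda>n. \<omega> \<in> space (env_measure p) - A n) sequentially"
    by (intro borel_cantelli_AE1 A) (auto simp: less_top[symmetric])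
  then show ?thesis
  proof (rule AE_mp, intro AE_I2 impI)
    fix \<omega> assume "eventually (\<lambda>n. \<omega> \<in> space (env_measure p) - A n) sequentially"
    then obtain n0 where n0: "\<And>n. n \<ge> n0 \<Longrightarrow> \<omega> \<notin> A n" by (auto simp: eventually_sequentially)
    have "{y. fst (\<omega> y)} \<subseteq> {- int n0..int n0}"
    proof
      fix y assume y: "y \<in> {y. fst (\<omega> y)}"
      have "\<omega> \<in> A (nat \<bar>y\<bar>)" using y by (cases "0 \<le> y") (auto simp: A_def lam_real_def)
      then have "nat \<bar>y\<bar> < n0" using n0 by (meson not_le)
      then show "y \<in> {- int n0..int n0}" by auto
    qed
    then show "finite {y. fst (\<omega> y)}" using finite_subset by blast
  qed
qed

text \<open>With blocks of length \<open>z ^ a\<close>, \<open>z ^ b\<close> of them, a block contains about \<open>z powr \<kappa>\<close> random sites,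
  \<open>\<kappa> = a - \<beta> * (a + b)\<close>. This must tend to infinity, while its square stays below the number of blocks
  for the concentration inequality.\<close>

lemma exponents_exist:
  fixes \<beta> :: real
  assumes "0 \<le> \<beta>" "\<beta> < 1"
  obtains a b :: nat where "0 < a" "0 < b" "\<beta> * (a + b) < a" "2 * (a - \<beta> * (a + b)) < b"
proof -
  \<comment> \<open>With \<open>q = a / (a + b)\<close> the two requirements become
    \<open>\<beta> < q\<close> and \<open>2 * (q - \<beta>) < 1 - q\<close>, that is,
    \<open>q < (1 + 2 * \<beta>) / 3\<close>; this leaves room exactly because
    \<open>\<beta> < 1\<close>.\<close>
  have "\<beta> < min 1 ((1 + 2 * \<beta>) / 3)" using assms by auto
  then obtain q where q: "q \<in> \<rat>" "\<beta> < q" "q < min 1 ((1 + 2 * \<beta>) / 3)" using Rats_dense_in_real by blast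
  from q(1) obtain a d :: nat where ad: "d \<noteq> 0" "\<bar>q\<bar> = a / d" using Rats_abs_nat_div_natE by metis
  then have qa: "q = a / d" using q assms by simp
  have a0: "0 < a" using qa q assms by (cases "a = 0") auto
  have "real a / real d < 1" using qa q by simp
  then have "real a < real d" using ad by (simp add: field_simps)
  then obtain b where b: "0 < b" "d = a + b" using less_imp_add_positive[of a d] by auto
  have 1: "\<beta> * d < a" using q(2) qa ad by (simp add: field_simps)
  have "3 * q < 1 + 2 * \<beta>" using q(3) by simp
  then have "3 * a < d + 2 * \<beta> * d" using qa ad by (simp add: field_simps)
  then have "2 * (a - \<beta> * d) < d - real a" by (simp add: algebra_simps)
  then have "2 * (a - \<beta> * (a + b)) < b" unfolding b(2) by simp
  moreover have "\<beta> * (a + b) < a" using 1 unfolding b(2) by simp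
  ultimately show ?thesis using that[of a b] a0 b(1) by blast
qed

section \<open>Almost sure fluctuations at all large scales\<close>

lemma (in env) AE_transient:
  assumes c: "0 < c" and \<beta>: "0 \<le> \<beta>" "\<beta> < 1" and p: "\<And>y. \<bar>y\<bar> \<ge> N0 \<Longrightarrow> p y = c * real_of_int \<bar>y\<bar> powr (-\<beta>)"
  shows "AE \<omega> in env_measure p. summable (\<lambda>n. walk_prob (eps_of f \<omega>) n (0,0) (0,0))"
proof -
  interpret prob_space "env_measure p" by (rule prob_space_env)
  obtain a b :: nat where ab: "0 < a" "0 < b" "\<beta> * (a + b) < a" "2 * (a - \<beta> * (a + b)) < b"
    using exponents_exist[OF \<beta>] by blast
  define \<kappa> where "\<kappa> = a - \<beta> * (a + b)"
  have \<kappa>: "0 < \<kappa>" "2 * \<kappa> < b" using ab by (auto simp: \<kappa>_def)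
  \<comment> \<open>The blocks of scale \<open>z\<close> lie between \<open>z ^ (a + b)\<close> and
    twice that height; \<open>pmax\<close> and \<open>pmin\<close> are the site probabilities at
    these two ends.\<close>
  define pmax pmin m where "pmax z = c * real z powr (- (\<beta> * (a + b)))"
    and "pmin z = 2 powr (-\<beta>) * pmax z" and "m z = 2 * (1 + real (z ^ a) * pmax z)" for z
  define w where "w = c * 2 powr (-\<beta>) / 256"
  define C where "C = 2 * F + 4 + 4 * c"
  have w: "0 < w" using c by (simp add: w_def)
  have C: "0 < C" using c F_nonneg by (simp add: C_def)
  have pmax0: "0 \<le> pmax z" for z using c by (simp add: pmax_def)
  have za: "real (z ^ a) * pmax z = c * z powr \<kappa>" if "1 \<le> z" for z
  proof -
    have "real (z ^ a) = real z powr a" using that by (simp add: powr_realpow)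
    then show ?thesis by (simp add: pmax_def \<kappa>_def powr_add[symmetric])
  qed
  have W: "real (z ^ b) * (pmin z * real (z ^ a) / 256) = w * real z ^ b * z powr \<kappa>" if "1 \<le> z" for z
    using za[OF that] by (simp add: pmin_def w_def) (metis mult.assoc mult.commute)
  have block_cap: "block_cap (m z) \<le> C * z powr \<kappa>" "0 < block_cap (m z)" if "1 \<le> z" for z
  proof -
    have "1 \<le> real z powr \<kappa>" using that \<kappa> by (intro ge_one_powr_ge_zero) auto
    then have "(2 * F + 4) * 1 \<le> (2 * F + 4) * real z powr \<kappa>" using F_nonneg by (intro mult_left_mono) auto
    then show "block_cap (m z) \<le> C * z powr \<kappa>" using za[OF that] by (simp add: block_cap_def m_def C_def algebra_simps)
    show "0 < block_cap (m z)" using F_nonneg mult_nonneg_nonneg[OF _ pmax0[of z], of "real z ^ a"]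
      by (simp add: block_cap_def m_def)
  qed
  have p_bounds: "pmin z \<le> p x \<and> p x \<le> pmax z"
    if z: "1 \<le> z" "N0 \<le> int z" and x: "int (z ^ b * z ^ a) \<le> x" "x \<le> int (2 * z ^ b * z ^ a)" for z x
  proof -
    have zD: "real (z ^ b * z ^ a) = real z powr (a + b)" using z(1) by (simp add: powr_realpow power_add flip: of_nat_add)
    have "real_of_int (int (z ^ b * z ^ a)) \<le> real_of_int x" by (rule of_int_le_iff[THEN iffD2, OF x(1)])
    then have x1: "real z powr (a + b) \<le> x" unfolding zD[symmetric] by simp
    have "real_of_int x \<le> real_of_int (int (2 * z ^ b * z ^ a))" by (rule of_int_le_iff[THEN iffD2, OF x(2)])
    then have x2: "x \<le> 2 * real z powr (a + b)" unfolding zD[symmetric] by simp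
    have zp: "0 < real z powr (a + b)" using z(1) by simp
    have "z ^ 1 \<le> z ^ (b + a)" using z(1) ab by (intro power_increasing) auto
    then have "int z \<le> int (z ^ b * z ^ a)" by (simp add: power_add flip: of_nat_power of_nat_mult)
    then have xN: "N0 \<le> \<bar>x\<bar>" and x0: "0 \<le> x" using z(2) x(1) by auto
    have px: "p x = c * real_of_int x powr (-\<beta>)" using p[OF xN] x0 by simp
    have xp: "0 < real_of_int x" using x1 zp by linarith
    have "real_of_int x powr (-\<beta>) \<le> (real z powr (a + b)) powr (-\<beta>)"
      using x1 zp \<beta> by (intro powr_mono2') auto
    moreover have "(2 * real z powr (a + b)) powr (-\<beta>) \<le> real_of_int x powr (-\<beta>)"
      using xp x2 \<beta> by (intro powr_mono2') auto
    ultimately show ?thesis using c unfolding px pmin_def pmax_def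
      by (simp add: powr_mult powr_powr mult.commute mult.left_commute)
  qed
  define A where "A z = {\<omega>. (\<Sum>j<z^b. block_energy (m z) (int ((z^b + j) * z^a)) (z^a) \<omega>) \<le> z^b * (pmin z * real (z^a) / 256)}" for z
  have A: "A z \<in> sets (env_measure p)" for z
  proof -
    have [measurable]: "block_energy (m z) (int ((z^b + j) * z^a)) (z^a) \<in> borel_measurable (env_measure p)" for j
      unfolding env_measure_def by (rule block_energy_measurable) simp
    have "A z = {\<omega>\<in>space (env_measure p). (\<Sum>j<z^b. block_energy (m z) (int ((z^b + j) * z^a)) (z^a) \<omega>) \<le> z^b * (pmin z * real (z^a) / 256)}"
      by (simp add: A_def)
    also have "\<dots> \<in> sets (env_measure p)" by measurable
    finally show ?thesis .
  qed
  define C2 where "C2 = 2 * w\<^sup>2 / C ^ 4"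
  \<comment> \<open>In Hoeffding's exponent the squared deviation is of order
    \<open>z powr (2 * b + 2 * \<kappa>)\<close> and the squared ranges total at most order
    \<open>z powr (b + 4 * \<kappa>)\<close>; the quotient has exponent
    \<open>q > 0\<close>.\<close>
  define q where "q = b - 2 * \<kappa>"
  have C2: "0 < C2" "0 < q" using w C \<kappa> by (auto simp: C2_def q_def)
  have A_le: "measure (env_measure p) (A z) \<le> exp (- C2 * z powr q)" if z: "2 \<le> z" "N0 \<le> int z" for z
  proof -
    have z1: "1 \<le> z" using z by simp
    have "z ^ 1 \<le> z ^ a" using z ab by (intro power_increasing) auto
    then have "2 \<le> z ^ a" using z by simp
    moreover have "0 < z ^ b" using z by simp
    ultimately have "measure (env_measure p) (A z) \<le> exp (- 2 * (real (z^b) * (pmin z * real (z^a) / 256))\<^sup>2 / (real (z^b) * (block_cap (m z)) ^ 4))"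
      unfolding A_def using prob_bad_le[of "z^a" "z^b" "m z" "pmax z" "pmin z"] p_bounds[OF z1 z(2)] pmax0[of z]
      by (simp add: m_def pmin_def)
    also have "\<dots> \<le> exp (- C2 * z powr q)"
    proof -
      have zb: "real z ^ b = real z powr b" using z1 by (simp add: powr_realpow)
      have "C2 * z powr q * (real (z^b) * (block_cap (m z)) ^ 4) \<le> C2 * z powr q * (real (z^b) * (C * z powr \<kappa>) ^ 4)"
        using block_cap[OF z1] C2 by (intro mult_left_mono power_mono) auto
      also have "\<dots> = 2 * w\<^sup>2 * (z powr q * real z ^ b * (z powr \<kappa>) ^ 4)"
        using C by (simp add: C2_def power_mult_distrib)
      also have "z powr q * real z ^ b * (z powr \<kappa>) ^ 4 = (real z ^ b * z powr \<kappa>)\<^sup>2"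
        unfolding zb q_def by (simp add: power2_eq_square power4_eq_xxxx powr_add[symmetric] add.commute)
      finally have "C2 * z powr q * (real (z^b) * (block_cap (m z)) ^ 4) \<le> 2 * (w * real z ^ b * z powr \<kappa>)\<^sup>2"
        by (simp add: power_mult_distrib mult_ac)
      then have "C2 * z powr q \<le> 2 * (w * real z ^ b * z powr \<kappa>)\<^sup>2 / (real (z^b) * (block_cap (m z)) ^ 4)"
        using block_cap(2)[OF z1] z1 by (subst pos_le_divide_eq) auto
      then show ?thesis unfolding W[OF z1] by simp
    qed
    finally show ?thesis .
  qed
  have "summable (\<lambda>z. measure (env_measure p) (A z))"
  proof (rule summable_comparison_test_ev)
    have "eventually (\<lambda>z. exp (- C2 * real z powr q) \<le> 1 / real z ^ 2) sequentially"
      using C2 by real_asymp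
    then show "eventually (\<lambda>z. norm (measure (env_measure p) (A z)) \<le> 1 / real z ^ 2) sequentially"
      using eventually_ge_at_top[of "max 2 (nat N0)"]
    proof eventually_elim
      case (elim z)
      then have "2 \<le> z" "N0 \<le> int z" by (auto simp: nat_le_iff)
      from A_le[OF this] show ?case using elim by simp
    qed
    show "summable (\<lambda>z. 1 / real z ^ 2)" using inverse_power_summable[of 2] by (simp add: inverse_eq_divide)
  qed
  then have "AE \<omega> in env_measure p. eventually (\<lambda>z. \<omega> \<in> space (env_measure p) - A z) sequentially"
    by (intro borel_cantelli_AE1 A) (auto simp: less_top[symmetric])
  then show ?thesis
  proof (rule AE_mp, intro AE_I2 impI)
    fix \<omega> assume ev: "eventually (\<lambda>z. \<omega> \<in> space (env_measure p) - A z) sequentially"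
    \<comment> \<open>The condition \<open>M^2 \<le> N * W\<close> of good blocks; it holds for
      large \<open>z\<close> since \<open>\<kappa> < 2 * b\<close>.\<close>
    have "eventually (\<lambda>z. C\<^sup>2 * real z powr (2 * \<kappa>) \<le> w * real z powr (2 * b + \<kappa>)) sequentially"
      using w C \<kappa> by real_asymp
    with ev eventually_ge_at_top[of "1::nat"]
    have "eventually (\<lambda>z. good_blocks (eps_of f \<omega>) (z^a) (z^b) (w * real z ^ b * z powr \<kappa>)) sequentially"
    proof eventually_elim
      case (elim z)
      have z1: "1 \<le> z" using elim by simp
      show ?case
      proof (rule good_blocks_of_sum[where m="m z"])
        show "0 < z ^ a" using z1 by simp
        show "1 \<le> m z" using pmax0[of z] by (simp add: m_def)
        have "(block_cap (m z))\<^sup>2 \<le> (C * z powr \<kappa>)\<^sup>2" using block_cap[OF z1] by (intro power_mono) auto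
        also have "\<dots> = C\<^sup>2 * real z powr (2 * \<kappa>)" by (simp add: power_mult_distrib power2_eq_square powr_add[symmetric])
        also have "\<dots> \<le> w * real z powr (2 * b + \<kappa>)" using elim by simp
        also have "\<dots> = real (z ^ b) * (w * real z ^ b * z powr \<kappa>)"
        proof -
          have "real z ^ b = real z powr b" using z1 by (simp add: powr_realpow)
          moreover have "real z powr (2 * real b + \<kappa>) = real z powr b * real z powr b * real z powr \<kappa>"
            by (simp only: mult_2 powr_add)
          ultimately show ?thesis by (simp only: of_nat_power of_nat_mult of_nat_numeral mult_ac)
        qed
        finally show "(block_cap (m z))\<^sup>2 \<le> real (z ^ b) * (w * real z ^ b * z powr \<kappa>)" .
        show "w * real z ^ b * z powr \<kappa> < (\<Sum>j<z^b. block_energy (m z) (int ((z^b + j) * z^a)) (z^a) \<omega>)"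
          using elim(1) unfolding A_def W[OF z1, symmetric] by simp
      qed
    qed
    then obtain z0 where "\<And>z. z \<ge> z0 \<Longrightarrow> good_blocks (eps_of f \<omega>) (z^a) (z^b) (w * real z ^ b * z powr \<kappa>)"
      by (auto simp: eventually_sequentially)
    then show "summable (\<lambda>n. walk_prob (eps_of f \<omega>) n (0,0) (0,0))"
      using ab \<kappa> w by (intro transience_from_blocks[of "eps_of f \<omega>" a b \<kappa> w z0] eps_pm) auto
  qed
qed

theorem theorem2:
  fixes Q :: int and f :: "int \<Rightarrow> int" and p :: "int \<Rightarrow> real" and c \<beta> :: real
  assumes "Q \<ge> 2" and "even Q"
    and "\<And>y. f y \<in> {-1, 1}"
    and "\<And>y. f (y + Q) = f y"
    and "(\<Sum>y = 1..Q. f y) = 0"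
    and "\<And>y. 0 \<le> p y \<and> p y \<le> 1"
    and "c > 0"
    and "\<exists>N. \<forall>y. \<bar>y\<bar> \<ge> N \<longrightarrow> p y = c * real_of_int \<bar>y\<bar> powr (-\<beta>)"
  shows "(\<beta> < 1 \<longrightarrow> (AE \<omega> in env_measure p.
            summable (\<lambda>n. walk_prob (eps_of f \<omega>) n (0,0) (0,0))))
       \<and> (\<beta> > 1 \<longrightarrow> (AE \<omega> in env_measure p.
            \<not> summable (\<lambda>n. walk_prob (eps_of f \<omega>) n (0,0) (0,0))))"
proof -
  obtain S F where S: "\<And>y. S y - S (y-1) = real_of_int (f y)" "\<And>y. \<bar>S y\<bar> \<le> F"
    using balanced_antiderivative[of Q f] assms(1,4,5) by auto
  interpret env p f S F by unfold_locales (use assms S in auto)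
  obtain N0 where p: "\<And>y. \<bar>y\<bar> \<ge> N0 \<Longrightarrow> p y = c * real_of_int \<bar>y\<bar> powr (-\<beta>)"
    using assms(8) by blast
  \<comment> \<open>A negative exponent would push \<open>p\<close> above 1 far from the origin. The
    sign is needed for the monotonicity of \<open>p\<close> across a scale.\<close>
  have \<beta>0: "0 \<le> \<beta>"
  proof (rule ccontr)
    assume "\<not> 0 \<le> \<beta>"
    then have "eventually (\<lambda>n. 1 < c * real n powr (-\<beta>)) sequentially"
      using assms(7) by real_asymp
    with eventually_ge_at_top[of "nat N0"]
    have "eventually (\<lambda>n. False) sequentially"
    proof eventually_elim
      case (elim n)
      then have "N0 \<le> int n" by (simp add: nat_le_iff)
      then show ?case using p[of "int n"] assms(6)[of "int n"] elim by simp
    qed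
    then show False by simp
  qed
  show ?thesis
  proof (intro conjI impI)
    assume "\<beta> < 1"
    then show "AE \<omega> in env_measure p. summable (\<lambda>n. walk_prob (eps_of f \<omega>) n (0,0) (0,0))"
      using AE_transient[OF assms(7) \<beta>0 _ p] by simp
  next
    assume "\<beta> > 1"
    then have "AE \<omega> in env_measure p. finite {y. fst (\<omega> y)}"
      using AE_finite_random_sites[OF assms(7) _ p] by simp
    then show "AE \<omega> in env_measure p. \<not> summable (\<lambda>n. walk_prob (eps_of f \<omega>) n (0,0) (0,0))"
      by (rule AE_mp) (intro AE_I2 impI recurrence_of_finite)
  qed
qed

end
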